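(* It is not true that for every prime $p$ and every finite $p$-group $G$ there exists a finite $p$-group $H$ with $\Phi(H)\cong[G,G]$. Explicitly, for $p=2$ and $G=\texttt{SmallGroup(256,511)}$, there is no finite $2$-group $H$ such that $\Phi(H)\cong [G,G]$.
   Context: For a finite $p$-group $H$, the Frattini subgroup $\Phi(H)$ is the intersection of all maximal subgroups of $H$. $[G,G]$ is the commutator subgroup. $\texttt{SmallGroup(256,511)}$ denotes the group of order $256$ with identification number $511$ in the GAP Small Groups Library (SmallGrp package, version 1.5.4). *)

theory Defs
  imports "HOL-Algebra.Sym_Groups" "HOL-Computational_Algebra.Primes"
begin

definition finite_p_group :: "nat \<Rightarrow> ('a, 'b) monoid_scheme \<Rightarrow> bool" where
  "finite_p_group p G \<longleftrightarrow> group G \<and> finite (carrier G) \<and> (\<exists>n. order G = p ^ n)"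

definition maximal_subgroup :: "'a set \<Rightarrow> ('a, 'b) monoid_scheme \<Rightarrow> bool" where
  "maximal_subgroup M G \<longleftrightarrow> subgroup M G \<and> M \<noteq> carrier G \<and>
     (\<forall>K. subgroup K G \<longrightarrow> M \<subseteq> K \<longrightarrow> K = M \<or> K = carrier G)"

(* The intersection with the carrier matters only for the trivial group, which has no maximal
   subgroup and is its own Frattini subgroup. *)
definition frattini :: "('a, 'b) monoid_scheme \<Rightarrow> 'a set" where
  "frattini G = carrier G \<inter> \<Inter>{M. maximal_subgroup M G}"

abbreviation frattini_group :: "('a, 'b) monoid_scheme \<Rightarrow> ('a, 'b) monoid_scheme" where
  "frattini_group G \<equiv> G\<lparr>carrier := frattini G\<rparr>"

abbreviation commutator_subgroup :: "('a, 'b) monoid_scheme \<Rightarrow> ('a, 'b) monoid_scheme" where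
  "commutator_subgroup G \<equiv> G\<lparr>carrier := derived G (carrier G)\<rparr>"

(* SmallGroup(256,511) as a transitive permutation group of degree 16.  The generators a and b
   are f1 and f2 of the power-commutator presentation in lemma SG_presentation below.  The
   identification with the catalogue entry comes from an independent enumeration of the
   two-generator groups of order 256, not from the catalogue data.  GAP multiplies permutations
   left to right, sym_group by composition; the resulting groups are isomorphic via inversion. *)
definition SG_a :: "nat \<Rightarrow> nat" where
  "SG_a = cycle_of_list [1,2] \<circ> cycle_of_list [3,4] \<circ> cycle_of_list [5,6,7,8] \<circ>
          cycle_of_list [9,10,11,12] \<circ> cycle_of_list [13,14,15,16]"

definition SG_b :: "nat \<Rightarrow> nat" where
  "SG_b = cycle_of_list [1,3] \<circ> cycle_of_list [2,5] \<circ> cycle_of_list [4,9] \<circ>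
          cycle_of_list [6,10] \<circ> cycle_of_list [7,13] \<circ> cycle_of_list [11,15]"

definition SmallGroup_256_511 :: "(nat \<Rightarrow> nat) monoid" where
  "SmallGroup_256_511 = (sym_group 16)\<lparr>carrier := generate (sym_group 16) {SG_a, SG_b}\<rparr>"

definition perm_table :: "nat list \<Rightarrow> nat \<Rightarrow> nat" where
  "perm_table xs = (\<lambda>x. if 1 \<le> x \<and> x \<le> length xs then xs ! (x - 1) else x)"

lemma perm_table_comp:
  assumes "length xs = length ys" "list_all (\<lambda>y. 1 \<le> y \<and> y \<le> length ys) ys"
  shows "perm_table xs \<circ> perm_table ys = perm_table (map (\<lambda>y. xs ! (y - 1)) ys)"
  using assms by (auto simp: perm_table_def fun_eq_iff list_all_length)

lemma nat_cases_16:
  fixes x :: nat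
  shows "x = 0 \<or> x = 1 \<or> x = 2 \<or> x = 3 \<or> x = 4 \<or> x = 5 \<or> x = 6 \<or> x
      = 7 \<or> x = 8 \<or> x = 9 \<or> x = 10 \<or> x = 11 \<or> x = 12 \<or> x = 13 \<or>
      x = 14 \<or> x = 15 \<or> x = 16 \<or> 16 < x"
  by presburger

lemma perm_table_id: "perm_table [1,2,3,4,5,6,7,8,9,10,11,12,13,14,15,16] = id"
proof
  fix x :: nat
  show "perm_table [1,2,3,4,5,6,7,8,9,10,11,12,13,14,15,16] x = id x"
    using nat_cases_16[of x] by (elim disjE) (simp_all add: perm_table_def)
qed

lemma SG_a_table: "SG_a = perm_table [2, 1, 4, 3, 6, 7, 8, 5, 10, 11, 12, 9, 14, 15, 16, 13]"
proof
  fix x :: nat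
  show "SG_a x = perm_table [2, 1, 4, 3, 6, 7, 8, 5, 10, 11, 12, 9, 14, 15, 16, 13] x"
    using nat_cases_16[of x] by (elim disjE) (simp_all add: SG_a_def perm_table_def transpose_def)
qed

lemma SG_b_table: "SG_b = perm_table [3, 5, 1, 9, 2, 10, 13, 8, 4, 6, 15, 12, 7, 14, 11, 16]"
proof
  fix x :: nat
  show "SG_b x = perm_table [3, 5, 1, 9, 2, 10, 13, 8, 4, 6, 15, 12, 7, 14, 11, 16] x"
    using nat_cases_16[of x] by (elim disjE) (simp_all add: SG_b_def perm_table_def transpose_def)
qed

(* A consistent power-commutator presentation on f1 = SG_a, f2 = SG_b, f3, ..., f8, with
   [x,y] = w written as x y = y x w.  The group it presents has order 256, and its centre is the
   subgroup of order 2 generated by f8.  Since f8 is not the identity here, the permutation group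
   is isomorphic to the presented group. *)
lemma SG_presentation:
  "\<exists>f3 f4 f5 f6 f7 f8.
     f8 \<noteq> id \<and>
     SG_a \<circ> SG_a = f4 \<and> SG_b \<circ> SG_b = id \<and> f3 \<circ> f3 = f7 \<and>
     f4 \<circ> f4 = id \<and> f5 \<circ> f5 = f7 \<circ> f8 \<and> f6 \<circ> f6 = f8 \<and>
     f7 \<circ> f7 = id \<and> f8 \<circ> f8 = id \<and>
     SG_b \<circ> SG_a = SG_a \<circ> SG_b \<circ> f3 \<and>
     f3 \<circ> SG_a = SG_a \<circ> f3 \<circ> f5 \<and>
     f3 \<circ> SG_b = SG_b \<circ> f3 \<circ> f7 \<and> f4 \<circ> SG_a = SG_a \<circ> f4 \<and>
     f4 \<circ> SG_b = SG_b \<circ> f4 \<circ> f5 \<circ> f8 \<and>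
     f4 \<circ> f3 = f3 \<circ> f4 \<circ> f6 \<circ> f7 \<and>
     f5 \<circ> SG_a = SG_a \<circ> f5 \<circ> f6 \<and>
     f5 \<circ> SG_b = SG_b \<circ> f5 \<circ> f7 \<circ> f8 \<and>
     f5 \<circ> f3 = f3 \<circ> f5 \<circ> f7 \<and>
     f5 \<circ> f4 = f4 \<circ> f5 \<circ> f7 \<circ> f8 \<and>
     f6 \<circ> SG_a = SG_a \<circ> f6 \<circ> f7 \<and>
     f6 \<circ> SG_b = SG_b \<circ> f6 \<circ> f7 \<and>
     f6 \<circ> f3 = f3 \<circ> f6 \<circ> f8 \<and>
     f6 \<circ> f4 = f4 \<circ> f6 \<circ> f8 \<and> f6 \<circ> f5 = f5 \<circ> f6 \<and>
     f7 \<circ> SG_a = SG_a \<circ> f7 \<circ> f8 \<and> f7 \<circ> SG_b = SG_b \<circ> f7 \<and>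
     f7 \<circ> f3 = f3 \<circ> f7 \<and> f7 \<circ> f4 = f4 \<circ> f7 \<and>
     f7 \<circ> f5 = f5 \<circ> f7 \<and> f7 \<circ> f6 = f6 \<circ> f7 \<and>
     f8 \<circ> SG_a = SG_a \<circ> f8 \<and> f8 \<circ> SG_b = SG_b \<circ> f8 \<and>
     f8 \<circ> f3 = f3 \<circ> f8 \<and> f8 \<circ> f4 = f4 \<circ> f8 \<and>
     f8 \<circ> f5 = f5 \<circ> f8 \<and> f8 \<circ> f6 = f6 \<circ> f8 \<and>
     f8 \<circ> f7 = f7 \<circ> f8"
  apply (rule exI[of _ "perm_table [8, 9, 12, 5, 4, 16, 13, 3, 2, 14, 15, 1, 7, 6, 11, 10]"])
  apply (rule exI[of _ "perm_table [1, 2, 3, 4, 7, 8, 5, 6, 11, 12, 9, 10, 15, 16, 13, 14]"])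
  apply (rule exI[of _ "perm_table [3, 13, 1, 15, 11, 6, 5, 8, 7, 10, 9, 12, 4, 16, 2, 14]"])
  apply (rule exI[of _ "perm_table [14, 13, 16, 15, 7, 8, 9, 10, 11, 12, 5, 6, 4, 3, 2, 1]"])
  apply (rule exI[of _ "perm_table [3, 2, 1, 4, 5, 10, 7, 12, 9, 6, 11, 8, 13, 16, 15, 14]"])
  apply (rule exI[of _ "perm_table [3, 4, 1, 2, 9, 10, 11, 12, 5, 6, 7, 8, 15, 16, 13, 14]"])
  apply (simp only: SG_a_table SG_b_table perm_table_id[symmetric])
  apply (intro conjI)
  subgoal by (auto simp: perm_table_def fun_eq_iff intro!: exI[of _ 1])
  by (simp_all add: perm_table_comp)

end

(* The commutator subgroup K of SmallGroup(256,511) has order 32, with generators x, y, z of order 4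
   and centre Z = {1, u, v, uv} = Phi(K), where x^2 = u, y^2 = uv, z^2 = v, [x,y] = u, [x,z] = v,
   [y,z] = 1.  The coset zZ is characteristic: it consists of the non-central k such that every
   element with the same square as k lies in kZ.  Hence v and the subgroup A = <y, z> Z = C(z) are
   characteristic as well, and an automorphism acts on K/Z as a power of the map
   x -> xy, y -> yz, z -> z, which has order 4.

   Suppose that Phi(H) = K for a finite 2-group H, and let h be in H.  Conjugation by h is an
   automorphism of K whose square is conjugation by h^2, an element of K, and therefore acts
   trivially on K/Z.  So conjugation by h acts on K/Z as the identity or as x -> xz, y -> y, z -> z;
   it maps y to some yc with c in Z and fixes Z pointwise,
   whence h^2 commutes with y, that is, h^2 lies in C(y) = A.  But Phi(H) is contained in every
   subgroup that contains all squares, so Phi(H) <= A, a contradiction. *)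

theory Submission
  imports Defs "HOL-Algebra.Left_Coset" "HOL-Algebra.Multiplicative_Group" "HOL-Algebra.Zassenhaus"
begin

section \<open>Frattini subgroups of finite p-groups\<close>

text \<open>The moved points are exactly those in orbits of size different from 1. By the
  orbit-stabilizer theorem such a size divides \<open>p ^ n\<close>, so it is a multiple of p, and
  these orbits partition the moved points.\<close>

lemma (in group_action) prime_dvd_card_non_fixed:
  assumes "Factorial_Ring.prime p" and ord: "order G = p ^ n" and "finite E"
  shows "p dvd card (E - {x \<in> E. \<forall>g \<in> carrier G. \<phi> g x = x})"
proof -
  let ?C = "{orb \<in> orbits G E \<phi>. card orb \<noteq> 1}"
  have finorb: "finite orb" if "orb \<in> orbits G E \<phi>" for orb
    using that orbits_coverture \<open>finite E\<close> by (metis Union_upper finite_subset)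
  have refl: "x \<in> orbit G \<phi> x" if "x \<in> E" for x
    using orbit_refl that by blast
  have "E - {x \<in> E. \<forall>g \<in> carrier G. \<phi> g x = x} = \<Union>?C"
  proof (intro subset_antisym subsetI)
    fix x assume x: "x \<in> E - {x \<in> E. \<forall>g \<in> carrier G. \<phi> g x = x}"
    then obtain g where g: "g \<in> carrier G" "\<phi> g x \<noteq> x" by blast
    have "orbit G \<phi> x \<in> ?C"
    proof -
      have "\<phi> g x \<in> orbit G \<phi> x" "x \<in> orbit G \<phi> x"
        using g x refl by (auto simp: orbit_def)
      then have "card (orbit G \<phi> x) \<noteq> 1"
        using g(2) by (auto simp: card_1_singleton_iff)
      then show ?thesis using x by (auto simp: orbits_def)
    qed
    then show "x \<in> \<Union>?C" using x refl by blast
  next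
    fix x assume "x \<in> \<Union>?C"
    then obtain orb where orb: "orb \<in> orbits G E \<phi>" "card orb \<noteq> 1" "x \<in> orb" by blast
    then have xE: "x \<in> E" using orbits_coverture by blast
    then have "orbit G \<phi> x \<in> orbits G E \<phi>" by (auto simp: orbits_def)
    with orb refl[OF xE] have eq: "orb = orbit G \<phi> x"
      using disjoint_union by blast
    have "\<not> (\<forall>g \<in> carrier G. \<phi> g x = x)"
    proof
      assume "\<forall>g \<in> carrier G. \<phi> g x = x"
      then have "orbit G \<phi> x = {x}" using refl[OF xE] by (auto simp: orbit_def)
      then show False using orb eq by simp
    qed
    with xE show "x \<in> E - {x \<in> E. \<forall>g \<in> carrier G. \<phi> g x = x}" by blast
  qed
  moreover have "p dvd card (\<Union>?C)"
  proof (rule dvd_partition)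
    show "finite (\<Union>?C)"
      using orbits_coverture \<open>finite E\<close> by (metis (no_types, lifting) Sup_subset_mono finite_subset mem_Collect_eq subsetI)
    show "\<forall>c\<in>?C. p dvd card c"
    proof
      fix c assume c: "c \<in> ?C"
      then obtain x where x: "x \<in> E" "c = orbit G \<phi> x" by (auto simp: orbits_def)
      have "card c dvd p ^ n"
        using orbit_stabilizer_theorem[OF x(1)] x(2) ord by (metis dvd_triv_left)
      then obtain k where "card c = p ^ k"
        using \<open>Factorial_Ring.prime p\<close> by (meson divides_primepow_nat)
      then show "p dvd card c" using c by (cases k) auto
    qed
    show "\<forall>c1\<in>?C. \<forall>c2\<in>?C. c1 \<noteq> c2 \<longrightarrow> c1 \<inter> c2 = {}"
      using disjoint_union by blast
  qed
  ultimately show ?thesis by simp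
qed

text \<open>Translation by \<open>inv g\<close> undoes translation by g. The maps are restricted to
  \<open>lcosets M\<close> because \<open>Bij\<close> consists of extensional functions.\<close>

lemma (in group) left_translation_action:
  assumes M: "subgroup M G"
  shows "group_action G (lcosets M) (\<lambda>g. \<lambda>X \<in> lcosets M. g <# X)"
proof -
  have Msub: "M \<subseteq> carrier G" using M by (rule subgroup.subset)
  have sub: "X \<subseteq> carrier G" if "X \<in> lcosets M" for X
    using that lcosets_subset_PowG[OF M] by blast
  have cl: "g <# X \<in> lcosets M" if "g \<in> carrier G" "X \<in> lcosets M" for g X
    using that Msub by (auto simp: LCOSETS_def lcos_m_assoc intro!: bexI[of _ "g \<otimes> _"])
  have bij: "(\<lambda>X \<in> lcosets M. g <# X) \<in> Bij (lcosets M)" if g: "g \<in> carrier G" for g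
  proof -
    have "bij_betw (\<lambda>X. g <# X) (lcosets M) (lcosets M)"
      using g by (intro bij_betw_byWitness[where f' = "\<lambda>X. inv g <# X"])
        (auto simp: cl lcos_m_assoc sub lcos_mult_one)
    then show ?thesis
      by (auto simp: Bij_def cong: bij_betw_cong)
  qed
  have "(\<lambda>g. \<lambda>X \<in> lcosets M. g <# X) \<in> hom G (BijGroup (lcosets M))"
  proof (rule homI)
    show "(\<lambda>X \<in> lcosets M. g <# X) \<in> carrier (BijGroup (lcosets M))" if "g \<in> carrier G" for g
      using bij[OF that] by (simp add: BijGroup_def)
    show "(\<lambda>X \<in> lcosets M. (g \<otimes> h) <# X) =
        (\<lambda>X \<in> lcosets M. g <# X) \<otimes>\<^bsub>BijGroup (lcosets M)\<^esub> (\<lambda>X \<in> lcosets M. h <# X)"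
      if "g \<in> carrier G" "h \<in> carrier G" for g h
      using that bij by (simp add: BijGroup_def compose_def)
        (rule restrict_ext, simp add: cl lcos_m_assoc sub)
  qed
  then show ?thesis
    by (simp add: group_action_def group_hom_def group_hom_axioms_def group_BijGroup is_group)
qed

text \<open>Let M act on its left cosets. As M is proper, their number is divisible by p, hence so
  is the number of fixed cosets. M itself is fixed, so there is another fixed coset gM, and mgM = gM
  for all m in M means that g conjugates M into itself.\<close>

lemma (in group) p_group_normalizer_grows:
  assumes p: "Factorial_Ring.prime p" and ord: "order G = p ^ n"
    and M: "subgroup M G" and ne: "M \<noteq> carrier G"
  shows "\<exists>g \<in> carrier G - M. \<forall>m \<in> M. inv g \<otimes> m \<otimes> g \<in> M"
proof -
  interpret M: subgroup M G by fact
  interpret act: group_action G "lcosets M" "\<lambda>g. \<lambda>X \<in> lcosets M. g <# X"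
    by (rule left_translation_action[OF M])
  interpret actM: group_action "G\<lparr>carrier := M\<rparr>" "lcosets M" "\<lambda>g. \<lambda>X \<in> lcosets M. g <# X"
    by (rule act.induced_action[OF M])
  have fin: "finite (carrier G)"
    using ord p by (metis order_gt_0_iff_finite power_eq_0_iff gr0I not_prime_0)
  have finL: "finite (lcosets M)"
    using fin by (simp add: LCOSETS_def)
  have lag: "card (lcosets M) * card M = p ^ n"
    using l_lagrange[OF fin M] ord by simp
  obtain i where i: "card (lcosets M) = p ^ i"
    using lag p by (metis divides_primepow_nat dvd_triv_left)
  obtain j where j: "card M = p ^ j"
    using lag p by (metis divides_primepow_nat dvd_triv_right)
  have "i \<noteq> 0"
  proof
    assume "i = 0"
    then have "card M = card (carrier G)" using lag i ord by (simp add: order_def)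
    then show False using ne fin M.subset card_subset_eq by blast
  qed
  define F where "F = {X \<in> lcosets M. \<forall>g \<in> M. g <# X = X}"
  have "p dvd card (lcosets M - F)"
  proof -
    have "F = {X \<in> lcosets M. \<forall>g \<in> carrier (G\<lparr>carrier := M\<rparr>). (\<lambda>X \<in> lcosets M. g <# X) X = X}"
      by (auto simp: F_def)
    then show ?thesis
      using actM.prime_dvd_card_non_fixed[OF p _ finL, of j] j by (simp add: order_def)
  qed
  moreover have "p dvd card (lcosets M)" using i \<open>i \<noteq> 0\<close> by simp
  moreover have FL: "F \<subseteq> lcosets M" by (auto simp: F_def)
  ultimately have "p dvd card F"
    using dvd_diffD1[OF _ _ card_mono[OF finL FL]]
    by (simp only: card_Diff_subset[OF finite_subset[OF FL finL] FL])
  moreover have MF: "M \<in> F"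
    using M by (auto simp: F_def LCOSETS_def coset_join3 lcos_mult_one M.subset intro!: bexI[of _ "\<one>"])
  ultimately have "F \<noteq> {M}"
    using p by (auto simp: not_prime_1)
  then obtain X where X: "X \<in> F" "X \<noteq> M" using MF by blast
  then obtain g where g: "g \<in> carrier G" "X = g <# M"
    by (auto simp: F_def LCOSETS_def)
  have "g \<notin> M" using X g coset_join3[OF g(1) M] by blast
  moreover have "inv g \<otimes> m \<otimes> g \<in> M" if m: "m \<in> M" for m
  proof -
    have "g \<in> X" using g lcos_self[OF g(1) M] by simp
    then have "m \<otimes> g \<in> m <# X" by (auto simp: l_coset_def)
    then have "m \<otimes> g \<in> g <# M" using X m g by (auto simp: F_def)
    then show ?thesis
      using M.lcos_module_imp[OF is_group g(1)] m g by (simp add: m_assoc)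
  qed
  ultimately show ?thesis using g by blast
qed

text \<open>The normalizer of M contains M and an element outside M, so by maximality it is the
  whole group.\<close>

lemma (in group) maximal_subgroup_normal:
  assumes p: "Factorial_Ring.prime p" and ord: "order G = p ^ n"
    and max: "maximal_subgroup M G"
  shows "M \<lhd> G"
proof -
  have M: "subgroup M G" and ne: "M \<noteq> carrier G"
    using max by (auto simp: maximal_subgroup_def)
  interpret M: subgroup M G by fact
  have fin: "finite (carrier G)"
    using ord p by (metis order_gt_0_iff_finite power_eq_0_iff gr0I not_prime_0)
  obtain g where g: "g \<in> carrier G" "g \<notin> M" "\<forall>m \<in> M. inv g \<otimes> m \<otimes> g \<in> M"
    using p_group_normalizer_grows[OF p ord M ne] by blast
  \<comment> \<open>Conjugation maps the finite set M injectively into itself, hence onto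
    itself.\<close>
  have "(\<lambda>m. inv g \<otimes> m \<otimes> g) ` M = M"
  proof (rule endo_inj_surj)
    show "finite M" using fin M.subset finite_subset by blast
    show "inj_on (\<lambda>m. inv g \<otimes> m \<otimes> g) M"
      using g by (auto simp: inj_on_def)
  qed (use g in auto)
  moreover have "inv g <# M #> g = (\<lambda>m. inv g \<otimes> m \<otimes> g) ` M"
    by (auto simp: l_coset_def r_coset_def)
  \<comment> \<open>Membership in \<open>normalizer\<close> is phrased with
    \<open>g <# M #> inv g\<close>, so the equality just obtained speaks of \<open>inv g\<close>;
    taking inverses then gives g.\<close>
  ultimately have "inv g \<in> normalizer G M"
    using g M.subset by (simp add: normalizer_def stabilizer_def)
  moreover have sub: "subgroup (normalizer G M) G"
    by (rule normalizer_imp_subgroup[OF M.subset])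
  ultimately have "g \<in> normalizer G M"
    using g by (metis inv_inv subgroup.m_inv_closed)
  moreover have nor: "M \<lhd> G\<lparr>carrier := normalizer G M\<rparr>"
    by (rule subgroup_in_normalizer[OF M])
  then have "M \<subseteq> normalizer G M"
    using normal_imp_subgroup subgroup.subset by fastforce
  ultimately have "normalizer G M = carrier G"
    using max sub g by (auto simp: maximal_subgroup_def)
  then show ?thesis using nor by simp
qed

text \<open>By maximality the product of M with the powers of \<open>h [^] p\<close> is M or G. If
  it is G, then h = m h^(pk) for some m in M, so h^(1 - pk) lies in M. The exponent 1 - pk is
  coprime to the order \<open>p ^ n\<close>, and a Bezout relation puts h into M.\<close>

lemma (in group) pow_prime_in_maximal_subgroup:
  assumes p: "Factorial_Ring.prime p" and ord: "order G = p ^ n"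
    and max: "maximal_subgroup M G" and h: "h \<in> carrier G"
  shows "h [^] p \<in> M"
proof (cases "h \<in> M")
  case True
  then show ?thesis using max 
    by (metis int_pow_int maximal_subgroup_def subgroup_int_pow_closed)
next
  case False
  have M: "subgroup M G" using max by (auto simp: maximal_subgroup_def)
  interpret M: subgroup M G by fact
  have nor: "M \<lhd> G" by (rule maximal_subgroup_normal[OF p ord max])
  let ?C = "generate G {h [^] p}"
  have C: "subgroup ?C G" using h by (intro generate_is_subgroup) auto
  have sub: "subgroup (M <#> ?C) G" by (rule mult_norm_subgroup[OF nor C])
  have M_le: "M \<subseteq> M <#> ?C"
    using generate.one[of G "{h [^] p}"] M.subset by (force simp: set_mult_def)
  have hp: "h [^] p \<in> M <#> ?C"
    using generate.incl[of "h [^] p" "{h [^] p}" G] M.one_closed h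
    unfolding set_mult_def by (metis (no_types, lifting) UN_iff insertI1 l_one nat_pow_closed)
  have "M <#> ?C \<noteq> carrier G"
  proof
    assume "M <#> ?C = carrier G"
    then obtain m c where m: "m \<in> M" "c \<in> ?C" "h = m \<otimes> c"
      using h unfolding set_mult_def by blast
    then obtain k :: int where c: "c = (h [^] p) [^] k"
      using generate_pow[of "h [^] p"] h by auto
    have c': "c = h [^] (int p * k)"
      using c h by (simp add: int_pow_pow flip: int_pow_int)
    have "h [^] (1 - int p * k) = h \<otimes> inv c"
      unfolding c' int_pow_diff[OF h] using h by simp
    also have "\<dots> = m"
    proof -
      have "c \<in> carrier G" unfolding c' using h by simp
      then show ?thesis using inv_solve_right[of m h c] m(3) M.mem_carrier[OF m(1)] h by blast
    qed
    finally have "h [^] (1 - int p * k) \<in> M" using m by simp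
    moreover have "h [^] (int p ^ n) \<in> M"
      using pow_order_eq_1[OF h] ord M.one_closed by (metis int_pow_int of_nat_power)
    moreover have "coprime (1 - int p * k) (int p)"
      by (rule coprimeI) (metis dvd_add dvd_mult2 diff_add_cancel)
    then have "coprime (1 - int p * k) (int p ^ n)" by simp
    then obtain r s where rs: "r * (1 - int p * k) + s * (int p ^ n) = 1"
      by (metis bezout_int coprime_imp_gcd_eq_1)
    have "h [^] (1::int) = (h [^] (1 - int p * k)) [^] r \<otimes> (h [^] (int p ^ n)) [^] s"
      using h rs by (simp add: int_pow_pow int_pow_mult[symmetric] mult.commute)
    ultimately have "h [^] (1::int) \<in> M"
      by (metis M M.m_closed subgroup_int_pow_closed)
    then show False using False h by simp
  qed
  then have "M <#> ?C = M"
    using max sub M_le by (auto simp: maximal_subgroup_def)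
  then show ?thesis using hp by simp
qed

lemma (in group) pow_prime_in_frattini:
  assumes "Factorial_Ring.prime p" "order G = p ^ n" "h \<in> carrier G"
  shows "h [^] p \<in> frattini G"
  using assms pow_prime_in_maximal_subgroup by (auto simp: frattini_def)

lemma (in group) frattini_subgroup: "subgroup (frattini G) G"
proof -
  have "frattini G = \<Inter>(insert (carrier G) {M. maximal_subgroup M G})"
    by (simp add: frattini_def)
  moreover have "subgroup \<dots> G"
    by (rule subgroups_Inter) (auto simp: maximal_subgroup_def subgroup_self)
  ultimately show ?thesis by simp
qed

lemma (in group) frattini_normal:
  assumes "Factorial_Ring.prime p" "order G = p ^ n"
  shows "frattini G \<lhd> G"
proof (rule normal_invI[OF frattini_subgroup])
  fix x h assume xh: "x \<in> carrier G" "h \<in> frattini G"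
  then have h: "h \<in> carrier G" "\<And>M. maximal_subgroup M G \<Longrightarrow> h \<in> M"
    by (auto simp: frattini_def)
  have "x \<otimes> h \<otimes> inv x \<in> M" if "maximal_subgroup M G" for M
    using maximal_subgroup_normal[OF assms that] h(2)[OF that] xh(1)
    by (simp add: normal_inv_iff)
  then show "x \<otimes> h \<otimes> inv x \<in> frattini G"
    using xh h by (auto simp: frattini_def)
qed

section \<open>Subgroups containing all squares\<close>

text \<open>Since k normalizes M and its square lies in M, the cosets M and kM, which may coincide,
  already make up the subgroup generated by M and k.\<close>

lemma (in group) subgroup_adjoin_root:
  assumes M: "subgroup M G" and k: "k \<in> carrier G" and kk: "k \<otimes> k \<in> M"
    and comm: "\<And>m. m \<in> M \<Longrightarrow> \<exists>m'\<in>M. m \<otimes> k = k \<otimes> m'"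
  shows "subgroup (M \<union> (\<lambda>m. k \<otimes> m) ` M) G"
proof (rule subgroupI)
  interpret M: subgroup M G by fact
  have conj: "k \<otimes> m \<otimes> k \<in> M" if "m \<in> M" for m
  proof -
    obtain m' where "m' \<in> M" "m \<otimes> k = k \<otimes> m'" using comm \<open>m \<in> M\<close> by blast
    then have "k \<otimes> m \<otimes> k = k \<otimes> k \<otimes> m'" using that k by (simp add: m_assoc)
    then show ?thesis using kk \<open>m' \<in> M\<close> by simp
  qed
  show "M \<union> (\<lambda>m. k \<otimes> m) ` M \<subseteq> carrier G" using k by auto
  show "M \<union> (\<lambda>m. k \<otimes> m) ` M \<noteq> {}" using M.one_closed by blast
  show "inv a \<in> M \<union> (\<lambda>m. k \<otimes> m) ` M" if a: "a \<in> M \<union> (\<lambda>m. k \<otimes> m) ` M" for a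
  proof (cases "a \<in> M")
    case False
    then obtain m where m: "m \<in> M" "a = k \<otimes> m" using a by blast
    \<comment> \<open>The inverse of km is k (kmk)^-1, and kmk lies in M.\<close>
    have "inv a = k \<otimes> inv (a \<otimes> k)"
      using m k by (simp add: inv_mult_group m_assoc[symmetric])
    moreover have "inv (a \<otimes> k) \<in> M" using conj[OF m(1)] m by simp
    ultimately show ?thesis by blast
  qed simp
  show "a \<otimes> b \<in> M \<union> (\<lambda>m. k \<otimes> m) ` M"
    if ab: "a \<in> M \<union> (\<lambda>m. k \<otimes> m) ` M" "b \<in> M \<union> (\<lambda>m. k \<otimes> m) ` M" for a b
  proof -
    have "a \<otimes> (k \<otimes> m) \<in> M \<union> (\<lambda>m. k \<otimes> m) ` M" if m: "m \<in> M" "a \<in> M" for m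
    proof -
      obtain m' where "m' \<in> M" "a \<otimes> k = k \<otimes> m'" using comm m by blast
      then have "a \<otimes> (k \<otimes> m) = k \<otimes> (m' \<otimes> m)" "m' \<otimes> m \<in> M"
        using m k by (auto simp: m_assoc[symmetric])
      then show ?thesis by blast
    qed
    moreover have "k \<otimes> m \<otimes> (k \<otimes> m') \<in> M" if "m \<in> M" "m' \<in> M" for m m'
    proof -
      have "k \<otimes> m \<otimes> (k \<otimes> m') = (k \<otimes> m \<otimes> k) \<otimes> m'" using that k by (simp add: m_assoc)
      then show ?thesis using conj[OF that(1)] that by simp
    qed
    moreover have "k \<otimes> m \<otimes> m' = k \<otimes> (m \<otimes> m')" if "m \<in> M" "m' \<in> M" for m m'
      using that k by (simp add: m_assoc)
    ultimately show ?thesis using ab by auto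
  qed
qed

text \<open>If g in the Frattini subgroup lies outside Q, choose M maximal among the subgroups that
  contain Q and avoid g. Because M contains all squares, it has index 2. So M is a maximal subgroup
  without g, a contradiction.\<close>

lemma (in group) frattini_subset_of_squares:
  assumes fin: "finite (carrier G)" and Q: "subgroup Q G"
    and sq: "\<And>h. h \<in> carrier G \<Longrightarrow> h \<otimes> h \<in> Q"
  shows "frattini G \<subseteq> Q"
proof (rule ccontr)
  assume "\<not> frattini G \<subseteq> Q"
  then obtain g where g: "g \<in> frattini G" "g \<notin> Q" by blast
  then have gc: "g \<in> carrier G" by (simp add: frattini_def)
  define S where "S = {K. subgroup K G \<and> Q \<subseteq> K \<and> g \<notin> K}"
  have "finite S"
    by (rule finite_subset[of _ "Pow (carrier G)"]) (auto simp: S_def fin dest: subgroup.subset)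
  moreover have "Q \<in> S" using Q g by (simp add: S_def)
  ultimately have "\<exists>M \<in> S. Q \<subseteq> M \<and> (\<forall>K \<in> S. M \<subseteq> K \<longrightarrow> M = K)"
    by (rule finite_has_maximal2)
  then obtain M where MS: "M \<in> S" and Mmax: "\<And>K. K \<in> S \<Longrightarrow> M \<subseteq> K \<Longrightarrow> K = M"
    by metis
  have M: "subgroup M G" "Q \<subseteq> M" "g \<notin> M" using MS by (simp_all add: S_def)
  interpret M: subgroup M G by fact
  have sqM: "h \<otimes> h \<in> M" if "h \<in> carrier G" for h using sq[OF that] M by blast
  have conj: "k \<otimes> m \<otimes> k \<in> M" if "k \<in> carrier G" "m \<in> M" for k m
  proof -
    \<comment> \<open>The square of km, multiplied by the inverse of m, is kmk.\<close>
    have "(k \<otimes> m) \<otimes> (k \<otimes> m) \<otimes> inv m \<in> M"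
      using that sqM by simp
    then show ?thesis using that by (simp add: m_assoc)
  qed
  have adj: "subgroup (M \<union> (\<lambda>m. k \<otimes> m) ` M) G" if k: "k \<in> carrier G" for k
  proof (rule subgroup_adjoin_root[OF M(1) k sqM[OF k]])
    fix m assume m: "m \<in> M"
    \<comment> \<open>Squares in M force normality: mk = k (k^-2 (kmk)).\<close>
    have "inv (k \<otimes> k) \<otimes> (k \<otimes> m \<otimes> k) \<in> M" using conj[OF k m] sqM[OF k] by simp
    then show "\<exists>m'\<in>M. m \<otimes> k = k \<otimes> m'"
      using m k by (intro bexI[of _ "inv (k \<otimes> k) \<otimes> (k \<otimes> m \<otimes> k)"])
        (simp_all add: inv_mult_group m_assoc, simp add: m_assoc[symmetric])
  qed
  \<comment> \<open>Adjoining any k outside M enlarges M, hence captures g, and g can only lie in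
    kM. So every coset other than M contains g.\<close>
  have reach: "g \<in> (\<lambda>m. k \<otimes> m) ` M" if k: "k \<in> carrier G" "k \<notin> M" for k
  proof (rule ccontr)
    assume "g \<notin> (\<lambda>m. k \<otimes> m) ` M"
    then have "M \<union> (\<lambda>m. k \<otimes> m) ` M = M"
      using M adj[OF k(1)] by (intro Mmax) (auto simp: S_def)
    moreover have "k \<in> (\<lambda>m. k \<otimes> m) ` M" using k by (intro image_eqI[of _ _ "\<one>"]) auto
    ultimately show False using k by blast
  qed
  have "maximal_subgroup M G"
    unfolding maximal_subgroup_def
  proof (intro conjI allI impI)
    show "subgroup M G" using M by simp
    show "M \<noteq> carrier G" using M gc by blast
    fix K assume K: "subgroup K G" "M \<subseteq> K"
    interpret K: subgroup K G by fact
    show "K = M \<or> K = carrier G"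
    proof (rule disjCI)
      assume "K \<noteq> carrier G"
      then obtain l where l: "l \<in> carrier G" "l \<notin> K" using K.subset by blast
      have gK: "g \<notin> K"
      proof
        assume "g \<in> K"
        obtain m where "m \<in> M" "g = l \<otimes> m" using reach l K by blast
        then have "l = g \<otimes> inv m" using l by (simp add: m_assoc)
        then show False using \<open>g \<in> K\<close> \<open>m \<in> M\<close> K l by auto
      qed
      show "K = M" using M K gK by (intro Mmax) (auto simp: S_def)
    qed
  qed
  then show False using g M by (auto simp: frattini_def)
qed

section \<open>The group of order 32\<close>

type_synonym bits5 = "bool \<times> bool \<times> bool \<times> bool \<times> bool"

text \<open>
  The tuple $(a, b, c, d, e)$ stands for $x^a y^b z^c u^d v^e$; the quadratic terms come from moving
  $x^{a'}$ to the left, with $yx = xyu$ and $zx = xzv$, and from the squares of $x$, $y$, $z$.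
\<close>
fun kmult :: "bits5 \<Rightarrow> bits5 \<Rightarrow> bits5" where
  "kmult (a, b, c, d, e) (a', b', c', d', e') =
    (a \<noteq> a', b \<noteq> b', c \<noteq> c',
     d \<noteq> (d' \<noteq> ((b \<and> a') \<noteq> ((a \<and> a') \<noteq> (b \<and> b')))),
     e \<noteq> (e' \<noteq> ((c \<and> a') \<noteq> ((b \<and> b') \<noteq> (c \<and> c')))))"

definition kgroup :: "bits5 monoid" where
  "kgroup = \<lparr>carrier = UNIV, mult = kmult, one = (False, False, False, False, False)\<rparr>"

text \<open>Polynomial arithmetic over the field of two elements, with \<open>\<noteq>\<close> as
  addition and \<open>\<and>\<close> as multiplication: products are distributed and sums are
  sorted.\<close>

lemma xor_simps:
  fixes a b c :: bool
  shows "((a \<noteq> b) \<noteq> c) = (a \<noteq> (b \<noteq> c))" "(a \<noteq> (b \<noteq> c)) = (b \<noteq> (a \<noteq> c))"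
   "(a \<noteq> b) = (b \<noteq> a)" "((a \<noteq> b) \<and> c) = ((a \<and> c) \<noteq> (b \<and> c))" "(c \<and> (a \<noteq> b)) = ((c \<and> a) \<noteq> (c \<and> b))"
  by auto

text \<open>The correction terms in the last two coordinates are bilinear in the first three
  coordinates of the two factors, hence form a cocycle.\<close>

lemma kmult_assoc: "kmult (kmult p q) r = kmult p (kmult q r)"
proof -
  obtain a b c d e where p: "p = (a,b,c,d,e)" by (cases p)
  obtain a' b' c' d' e' where q: "q = (a',b',c',d',e')" by (cases q)
  obtain a'' b'' c'' d'' e'' where r: "r = (a'',b'',c'',d'',e'')" by (cases r)
  show ?thesis unfolding p q r
   unfolding kmult.simps prod.inject by (intro conjI; simp only: xor_simps)
qed
lemma group_kgroup: "group kgroup"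
proof (rule groupI)
  fix p :: bits5
  obtain a b c d e where "p = (a, b, c, d, e)" by (cases p)
  \<comment> \<open>The inverse has the same first three coordinates; its last two absorb the
    correction terms of the square.\<close>
  then have "kmult (a, b, c, d \<noteq> (a \<noteq> ((b \<and> a) \<noteq> b)), e \<noteq> ((c \<and> a) \<noteq> (b \<noteq> c))) p = \<one>\<^bsub>kgroup\<^esub>"
    by (auto simp: kgroup_def)
  then show "\<exists>q \<in> carrier kgroup. q \<otimes>\<^bsub>kgroup\<^esub> p = \<one>\<^bsub>kgroup\<^esub>"
    by (force simp: kgroup_def)
qed (auto simp: kgroup_def kmult_assoc)

text \<open>The u-coordinate of a square is \<open>a \<or> b\<close>, and if both vanish the
  v-coordinate is \<open>c\<close>. So the centre is the set of elements with trivial square, a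
  description that automorphisms respect.\<close>

lemma kmult_square_eq_one_iff:
  "kmult p p = (False, False, False, False, False) \<longleftrightarrow> (\<exists>d e. p = (False, False, False, d, e))"
  by (cases p) auto

text \<open>
  Singles out the coset $zZ$ by a condition that automorphisms preserve: among the three nontrivial
  squares, only $v$ has all its square roots in a single coset of $Z$.
\<close>
lemma isolated_square_iff:
  "(kmult p p \<noteq> (False, False, False, False, False) \<and>
     (\<forall>q. kmult q q = kmult p p \<longrightarrow> kmult (kmult q p) (kmult q p) = (False, False, False, False, False)))
   \<longleftrightarrow> (\<exists>d e. p = (False, False, True, d, e))" (is "?L \<longleftrightarrow> ?R")
proof
  obtain a b c d e where p: "p = (a, b, c, d, e)" by (cases p)
  show ?R if ?L
  proof -
    from \<open>?L\<close> have sq: "kmult p p \<noteq> (False, False, False, False, False)"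
      and *: "\<And>q. kmult q q = kmult p p \<Longrightarrow>
        kmult (kmult q p) (kmult q p) = (False, False, False, False, False)" by blast+
    \<comment> \<open>If a is set, the square does not depend on c. Flipping c gives a root whose
      product with p lies in zZ and squares to v.\<close>
    have "\<not> a" using *[of "(a, b, \<not> c, d, e)"] by (cases a; cases b; cases c) (auto simp: p)
    \<comment> \<open>The element yz^c has the same square as the witness, which is x or xy and lies
      in another coset of Z.\<close>
    moreover have "\<not> (\<not> a \<and> b)"
      using *[of "(True, \<not> c, False, False, False)"] by (cases c) (auto simp: p)
    ultimately show ?R using sq by (cases c) (auto simp: p)
  qed
  assume ?R
  then obtain d e where p: "p = (False, False, True, d, e)" by blast
  have "kmult (kmult q p) (kmult q p) = (False, False, False, False, False)"
    if "kmult q q = kmult p p" for q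
    using that by (cases q; rename_tac a b c d e; case_tac a; case_tac b; case_tac c) (simp_all add: p)
  moreover have "kmult p p \<noteq> (False, False, False, False, False)" by (simp add: p)
  ultimately show ?L by blast
qed

section \<open>Automorphisms of the group of order 32\<close>

text \<open>The hypothesis \<open>inner\<close> says that the square of \<open>\<phi>\<close> is
  conjugation by k. The argument forces \<open>\<phi>\<close> to fix Z pointwise and to preserve yZ;
  then its square fixes y, so k commutes with y and cannot involve x.\<close>

lemma automorphism_square_inner:
  assumes hom: "\<And>p q. \<phi> (kmult p q) = kmult (\<phi> p) (\<phi> q)"
    and bij: "bij \<phi>"
    and inner: "\<And>p. kmult (\<phi> (\<phi> p)) k = kmult k p"
  shows "\<not> fst k"
proof -
  let ?O = "(False, False, False, False, False)"
  have phi1: "\<phi> ?O = ?O"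
  proof -
    have "kmult (\<phi> ?O) (\<phi> ?O) = \<phi> ?O" using hom[of ?O ?O] by simp
    then show ?thesis by (cases "\<phi> ?O") auto
  qed
  have phi_eq: "\<phi> p = \<phi> q \<longleftrightarrow> p = q" for p q
    using bij by (metis bij_pointE)
  have center: "(\<exists>d e. \<phi> p = (False, False, False, d, e)) \<longleftrightarrow> (\<exists>d e. p = (False, False, False, d, e))" for p
    unfolding kmult_square_eq_one_iff[symmetric] hom[symmetric] using phi_eq phi1 by metis
  have dist: "(\<exists>d e. \<phi> p = (False, False, True, d, e)) \<longleftrightarrow> (\<exists>d e. p = (False, False, True, d, e))" for p
  proof -
    have sq: "kmult (\<phi> p) (\<phi> p) = ?O \<longleftrightarrow> kmult p p = ?O"
      unfolding hom[symmetric] using phi_eq[of "kmult p p" ?O] phi1 by simp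
    \<comment> \<open>Surjectivity allows q to be replaced by \<open>\<phi> q\<close>; the relation
      is then pulled back through \<open>\<phi>\<close>.\<close>
    have "(\<forall>q. kmult q q = kmult (\<phi> p) (\<phi> p) \<longrightarrow> kmult (kmult q (\<phi> p)) (kmult q (\<phi> p)) = ?O) \<longleftrightarrow>
      (\<forall>q. kmult (\<phi> q) (\<phi> q) = kmult (\<phi> p) (\<phi> p) \<longrightarrow> kmult (kmult (\<phi> q) (\<phi> p)) (kmult (\<phi> q) (\<phi> p)) = ?O)"
      using bij by (metis bij_pointE)
    also have "\<dots> \<longleftrightarrow> (\<forall>q. kmult q q = kmult p p \<longrightarrow> kmult (kmult q p) (kmult q p) = ?O)"
      unfolding hom[symmetric] using phi_eq phi1 by metis
    finally show ?thesis
      by (simp only: isolated_square_iff[symmetric] sq)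
  qed
  let ?x = "(True, False, False, False, False)" and ?y = "(False, True, False, False, False)"
    and ?z = "(False, False, True, False, False)" and ?u = "(False, False, False, True, False)"
    and ?v = "(False, False, False, False, True)"
  obtain z1 z2 where z: "\<phi> ?z = (False, False, True, z1, z2)" using dist[of ?z] by auto
  \<comment> \<open>v is the square of z, and every element of zZ has the same square.\<close>
  have v: "\<phi> ?v = ?v" using hom[of ?z ?z] z by simp
  obtain y1 y2 y3 y4 y5 where y: "\<phi> ?y = (y1, y2, y3, y4, y5)" by (cases "\<phi> ?y")
  obtain x1 x2 x3 x4 x5 where x: "\<phi> ?x = (x1, x2, x3, x4, x5)" by (cases "\<phi> ?x")
  obtain u1 u2 where u: "\<phi> ?u = (False, False, False, u1, u2)" using center[of ?u] by auto
  \<comment> \<open>y commutes with z, whereas an element involving x does not commute with an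
    element of zZ.\<close>
  have yz: "\<not> y1" using hom[of ?y ?z] hom[of ?z ?y] y z by auto
  \<comment> \<open>Without y2 the image of y would lie in Z or zZ, both of which are preserved in
    both directions.\<close>
  have y2: "y2" using center[of ?y] dist[of ?y] y yz by (cases y2; cases y3) auto
  \<comment> \<open>The relation zx = xzv is carried to the images, so the image of x does not
    commute with that of z.\<close>
  have x1: "x1" using hom[of ?x ?z] hom[of "(True, False, True, False, False)" ?v] hom[of ?z ?x] x z v
    by auto
  have uu: "\<phi> ?u = kmult (\<phi> ?x) (\<phi> ?x)" using hom[of ?x ?x] by simp
  have uv: "kmult (\<phi> ?u) ?v = kmult (\<phi> ?y) (\<phi> ?y)"
    using hom[of ?y ?y] hom[of ?u ?v] v by simp
  have dec: "\<phi> (a, b, c, d, e) = kmult (if a then \<phi> ?x else ?O) (kmult (if b then \<phi> ?y else ?O)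
     (kmult (if c then \<phi> ?z else ?O) (kmult (if d then \<phi> ?u else ?O) (if e then \<phi> ?v else ?O))))"
    for a b c d e
  proof -
    have "(a, b, c, d, e) = kmult (if a then ?x else ?O) (kmult (if b then ?y else ?O)
     (kmult (if c then ?z else ?O) (kmult (if d then ?u else ?O) (if e then ?v else ?O))))" by auto
    then show ?thesis by (simp add: hom phi1 if_distrib[of \<phi>] del: kmult.simps)
  qed
  obtain k1 k2 k3 k4 k5 where k: "k = (k1, k2, k3, k4, k5)" by (cases k)
  \<comment> \<open>Comparing \<open>uu\<close> with \<open>uv\<close> gives x2 = y3. If both were
    set, \<open>\<phi>\<close> would multiply x by y, up to a power of z, and y by z modulo Z. Its
    square would then send x to xz modulo Z, where conjugation by k acts trivially.\<close>
  have y3: "\<not> y3"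
  proof
    assume y3
    then show False
      using inner[of ?x] uu uv y2 yz x1 unfolding k x u y v dec[of x1 x2 x3 x4 x5] z
      by (cases x4) auto
  qed
  have uval: "\<phi> ?u = ?u" using uv y u y2 y3 yz by auto
  \<comment> \<open>Here \<open>\<phi>\<close> multiplies y by some c in Z and fixes c, so applying
    it twice multiplies y by c^2 = 1.\<close>
  have "\<phi> (\<phi> ?y) = ?y"
    using y2 y3 yz unfolding y dec[of y1 y2 y3 y4 y5] uval v
    by (cases y4; cases y5) (simp_all add: y)
  then show ?thesis using inner[of ?y] by (auto simp: k)
qed

text \<open>Under an isomorphism f, conjugation by h becomes an automorphism of
  \<open>kgroup\<close> whose square is conjugation by the element k with h^2 = f k. All squares
  thus lie in the image of the index-2 subgroup generated by y, z and Z, which then contains the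
  Frattini subgroup but not the image of x.\<close>

lemma (in group) frattini_not_iso_kgroup:
  assumes fin: "finite (carrier G)" and ord: "order G = 2 ^ n"
  shows "\<not> frattini_group G \<cong> kgroup"
proof
  assume iso: "frattini_group G \<cong> kgroup"
  have prime2: "Factorial_Ring.prime (2::nat)" by simp
  have sub: "subgroup (frattini G) G" by (rule frattini_subgroup)
  interpret F: subgroup "frattini G" G by (rule sub)
  have "group (frattini_group G)" by (rule subgroup_imp_group[OF sub])
  then have "kgroup \<cong> frattini_group G" using iso by (rule group.iso_sym)
  then obtain f where f: "f \<in> iso kgroup (frattini_group G)" by (auto simp: is_iso_def)
  then have f_mult: "f (kmult p q) = f p \<otimes> f q" and bij: "bij_betw f UNIV (frattini G)" for p q
    by (auto simp: iso_def hom_def kgroup_def simp del: split_paired_All)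
  have f_mem: "f p \<in> frattini G" for p using bij by (auto simp: bij_betw_def)
  then have f_car: "f p \<in> carrier G" for p by simp
  have f_eq: "f p = f q \<longleftrightarrow> p = q" for p q using bij by (simp add: bij_betw_def inj_eq)
  have f_ex: "\<exists>p. x = f p" if "x \<in> frattini G" for x
    using that bij by (force simp: bij_betw_def)
  have inv_f_ex: "\<exists>q. inv (f p) = f q" for p using f_mem by (intro f_ex) simp
  have sq: "\<exists>k. h \<otimes> h = f k \<and> \<not> fst k" if h: "h \<in> carrier G" for h
  proof -
    have "h [^] (2::nat) \<in> frattini G" by (rule pow_prime_in_frattini[OF prime2 ord h])
    then have "h \<otimes> h \<in> frattini G" using h by (simp add: numeral_2_eq_2)
    then obtain k where k: "h \<otimes> h = f k" using f_ex by blast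
    have conj_ex: "\<exists>q. x \<otimes> f p \<otimes> inv x = f q" if "x \<in> carrier G" for p x
      using that frattini_normal[OF prime2 ord] f_mem by (intro f_ex) (simp add: normal_inv_iff)
    then obtain \<phi> where phi: "\<And>p. h \<otimes> f p \<otimes> inv h = f (\<phi> p)" using h by metis
    have "\<not> fst k"
    proof (rule automorphism_square_inner[of \<phi>])
      show "\<phi> (kmult p q) = kmult (\<phi> p) (\<phi> q)" for p q
      proof -
        have "f (\<phi> (kmult p q)) = (h \<otimes> f p \<otimes> inv h) \<otimes> (h \<otimes> f q \<otimes> inv h)"
          using h f_car by (simp add: phi[symmetric] f_mult m_assoc inv_solve_left)
        then show ?thesis by (simp add: phi flip: f_mult f_eq)
      qed
      have "inj \<phi>"
      proof (rule injI)
        fix p q assume "\<phi> p = \<phi> q"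
        then have "h \<otimes> f p \<otimes> inv h = h \<otimes> f q \<otimes> inv h" by (simp add: phi)
        then show "p = q" using h f_car by (simp add: f_eq)
      qed
      then show "bij \<phi>" using finite_UNIV_inj_surj[of \<phi>] by (auto simp: bij_def)
      show "kmult (\<phi> (\<phi> p)) k = kmult k p" for p
      proof -
        have "f (\<phi> (\<phi> p)) = h \<otimes> h \<otimes> f p \<otimes> inv h \<otimes> inv h"
          using h f_car by (simp add: phi[symmetric] m_assoc)
        then have "f (\<phi> (\<phi> p)) \<otimes> (h \<otimes> h) = h \<otimes> h \<otimes> f p"
          using h f_car by (simp add: m_assoc) (simp add: m_assoc[symmetric])
        then show ?thesis by (simp add: k flip: f_mult f_eq)
      qed
    qed
    then show ?thesis using k by blast
  qed
  let ?A = "f ` {k. \<not> fst k}"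
  have "subgroup ?A G"
  proof (rule subgroupI)
    show "?A \<subseteq> carrier G" using f_car by auto
    show "?A \<noteq> {}" by (auto intro: exI[of _ "(False, False)"])
    fix x y assume "x \<in> ?A" "y \<in> ?A"
    then obtain p q where pq: "x = f p" "\<not> fst p" "y = f q" "\<not> fst q" by blast
    then have "\<not> fst (kmult p q)" by (cases p; cases q) auto
    then show "x \<otimes> y \<in> ?A" using pq by (auto simp flip: f_mult)
    obtain r where r: "inv x = f r" using inv_f_ex pq by blast
    \<comment> \<open>The first coordinate is additive, so prp = p shows that r and p agree in
      it.\<close>
    have "f (kmult (kmult p r) p) = f p" 
      using f_car[of p] r by (simp add: f_mult pq(1) flip: r)
    then have "kmult (kmult p r) p = p" by (simp add: f_eq)
    then have "\<not> fst r" using pq(2) by (cases p; cases r) auto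
    then show "inv x \<in> ?A" using r by blast
  qed
  then have "frattini G \<subseteq> ?A"
    using sq by (intro frattini_subset_of_squares[OF fin]) blast+
  then have "f (True, False, False, False, False) \<in> ?A" using f_mem by blast
  then show False by (auto simp: f_eq)
qed

section \<open>Generators and commutators modulo a normal subgroup\<close>

text \<open>The hypothesis gives only s^-1 N s inside N, which settles the inverses of generators.
  For the generators themselves, finiteness of N turns the inclusion into equality.\<close>

lemma (in group) normal_if_generators_normalize:
  assumes N: "subgroup N G" and fin: "finite N" and S: "S \<subseteq> carrier G"
    and gen: "carrier G = generate G S"
    and conj: "\<And>s n. s \<in> S \<Longrightarrow> n \<in> N \<Longrightarrow> \<exists>n'\<in>N. n \<otimes> s = s \<otimes> n'"
  shows "N \<lhd> G"
proof (rule normal_invI[OF N])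
  interpret N: subgroup N G by fact
  have gen_conj: "\<forall>n \<in> N. g \<otimes> n \<otimes> inv g \<in> N" if "g \<in> generate G S" for g
    using that
  proof induction
    case (inv s)
    have s: "s \<in> carrier G" using inv S by blast
    show ?case
    proof
      fix n assume n: "n \<in> N"
      then obtain n' where n': "n' \<in> N" "n \<otimes> s = s \<otimes> n'" using conj inv by blast
      then have "inv s \<otimes> n \<otimes> s = n'" using s n by (simp add: m_assoc) (simp add: m_assoc[symmetric])
      then show "inv s \<otimes> n \<otimes> inv (inv s) \<in> N" using n' s by simp
    qed
  next
    case (incl s)
    have s: "s \<in> carrier G" using incl S by blast
    have "(\<lambda>n. inv s \<otimes> n \<otimes> s) ` N = N"
    proof (rule endo_inj_surj[OF fin])
      show "inj_on (\<lambda>n. inv s \<otimes> n \<otimes> s) N" using s by (auto simp: inj_on_def)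
      show "(\<lambda>n. inv s \<otimes> n \<otimes> s) ` N \<subseteq> N"
      proof
        fix m assume "m \<in> (\<lambda>n. inv s \<otimes> n \<otimes> s) ` N"
        then obtain n where n: "n \<in> N" "m = inv s \<otimes> n \<otimes> s" by blast
        then obtain n' where n': "n' \<in> N" "n \<otimes> s = s \<otimes> n'" using conj incl by blast
        then have "m = n'" using s n by (simp add: m_assoc) (simp add: m_assoc[symmetric])
        then show "m \<in> N" using n' by simp
      qed
    qed
    then show ?case
    proof (intro ballI)
      fix n assume im: "(\<lambda>n. inv s \<otimes> n \<otimes> s) ` N = N" and "n \<in> N"
      then obtain m where m: "m \<in> N" "n = inv s \<otimes> m \<otimes> s" by blast
      then have "s \<otimes> n \<otimes> inv s = m" using s by (simp add: m_assoc) (simp add: m_assoc[symmetric])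
      then show "s \<otimes> n \<otimes> inv s \<in> N" using m by simp
    qed
  next
    case (eng g h)
    then have gh: "g \<in> carrier G" "h \<in> carrier G" using gen by auto
    show ?case
    proof
      fix n assume n: "n \<in> N"
      then have "g \<otimes> (h \<otimes> n \<otimes> inv h) \<otimes> inv g \<in> N" using eng by blast
      then show "g \<otimes> h \<otimes> n \<otimes> inv (g \<otimes> h) \<in> N"
        using gh n by (simp add: m_assoc inv_mult_group)
    qed
  qed simp
  then show "x \<otimes> h \<otimes> inv x \<in> N" if "x \<in> carrier G" "h \<in> N" for x h
    using that gen by blast
qed

text \<open>This set is the preimage in G of the centralizer of hN in G/N; normality lets the error
  terms move past group elements.\<close>

lemma (in group) commuting_mod_normal_subgroup:
  assumes N: "N \<lhd> G" and h: "h \<in> carrier G"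
  shows "subgroup {g \<in> carrier G. \<exists>n\<in>N. g \<otimes> h = h \<otimes> g \<otimes> n} G"
proof (rule subgroupI)
  interpret N: normal N G by fact
  have move: "\<exists>n'\<in>N. n \<otimes> g = g \<otimes> n'" if "n \<in> N" "g \<in> carrier G" for n g
    using that N.inv_op_closed1[of g n]
    by (intro bexI[of _ "inv g \<otimes> n \<otimes> g"]) (simp_all add: m_assoc, simp add: m_assoc[symmetric])
  show "{g \<in> carrier G. \<exists>n\<in>N. g \<otimes> h = h \<otimes> g \<otimes> n} \<subseteq> carrier G" by blast
  show "{g \<in> carrier G. \<exists>n\<in>N. g \<otimes> h = h \<otimes> g \<otimes> n} \<noteq> {}"
    using h by (auto intro!: exI[of _ \<one>] bexI[of _ \<one>])
  show "inv g \<in> {g \<in> carrier G. \<exists>n\<in>N. g \<otimes> h = h \<otimes> g \<otimes> n}"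
    if g: "g \<in> {g \<in> carrier G. \<exists>n\<in>N. g \<otimes> h = h \<otimes> g \<otimes> n}" for g
  proof -
    obtain n where n: "g \<in> carrier G" "n \<in> N" "g \<otimes> h = h \<otimes> g \<otimes> n" using g by blast
    obtain n' where n': "n' \<in> N" "inv n \<otimes> inv g = inv g \<otimes> n'" using move[of "inv n" "inv g"] n by auto
    have "inv g \<otimes> h = h \<otimes> (inv n \<otimes> inv g)"
    proof -
      have "h = inv g \<otimes> (h \<otimes> g \<otimes> n)"
        using n h by (simp add: m_assoc[symmetric] flip: n(3))
      then have "h \<otimes> inv (g \<otimes> n) = inv g \<otimes> h"
        using n h by (metis N.mem_carrier inv_closed inv_solve_right m_assoc m_closed)
      then show ?thesis using n by (simp add: inv_mult_group)
    qed
    then have "inv g \<otimes> h = h \<otimes> inv g \<otimes> n'" using n n' h by (simp add: m_assoc)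
    then show ?thesis using n n' by blast
  qed
  show "g \<otimes> g' \<in> {g \<in> carrier G. \<exists>n\<in>N. g \<otimes> h = h \<otimes> g \<otimes> n}"
    if g: "g \<in> {g \<in> carrier G. \<exists>n\<in>N. g \<otimes> h = h \<otimes> g \<otimes> n}"
and g': "g' \<in> {g \<in> carrier G. \<exists>n\<in>N. g \<otimes> h = h \<otimes> g \<otimes> n}" for g g'
  proof -
    obtain n where n: "g \<in> carrier G" "n \<in> N" "g \<otimes> h = h \<otimes> g \<otimes> n" using g by blast
    obtain n' where n': "g' \<in> carrier G" "n' \<in> N" "g' \<otimes> h = h \<otimes> g' \<otimes> n'" using g' by blast
    obtain n'' where n'': "n'' \<in> N" "n \<otimes> g' = g' \<otimes> n''" using move n n' by blast
    have "g \<otimes> g' \<otimes> h = (g \<otimes> h) \<otimes> (g' \<otimes> n')" using n(1) n' h by (simp add: m_assoc)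
    also have "\<dots> = h \<otimes> g \<otimes> (n \<otimes> g') \<otimes> n'" unfolding n(3) using n(1,2) n'(1,2) h by (simp add: m_assoc)
    also have "\<dots> = h \<otimes> (g \<otimes> g') \<otimes> (n'' \<otimes> n')"
      unfolding n''(2) using n(1) n'(1,2) n''(1) h by (simp add: m_assoc)
    finally show ?thesis using n(1) n'(1,2) n''(1) by blast
  qed
qed

text \<open>G/N is abelian because its generators commute. With \<open>C h\<close> the elements
  commuting with h modulo N, first \<open>C t\<close> is all of G for each generator t; by symmetry
  each \<open>C g\<close> contains the generators and so is all of G.\<close>

lemma (in group) derived_subset_if_generators_commute_mod:
  assumes N: "N \<lhd> G" and S: "S \<subseteq> carrier G" and gen: "carrier G = generate G S"
    and comm: "\<And>s t. s \<in> S \<Longrightarrow> t \<in> S \<Longrightarrow> \<exists>n\<in>N. s \<otimes> t = t \<otimes> s \<otimes> n"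
  shows "derived G (carrier G) \<subseteq> N"
proof -
  interpret N: normal N G by fact
  define C where "C h = {g \<in> carrier G. \<exists>n\<in>N. g \<otimes> h = h \<otimes> g \<otimes> n}" for h
  have C: "subgroup (C h) G" if "h \<in> carrier G" for h
    unfolding C_def by (rule commuting_mod_normal_subgroup[OF N that])
  have C_sym: "h \<in> C g" if gh: "g \<in> C h" "h \<in> carrier G" for g h
  proof -
    obtain n where n: "g \<in> carrier G" "n \<in> N" "g \<otimes> h = h \<otimes> g \<otimes> n"
      using gh by (auto simp: C_def)
    then have "h \<otimes> g = g \<otimes> h \<otimes> inv n" using gh(2) by (simp add: m_assoc)
    then show ?thesis using n gh(2) by (auto simp: C_def intro!: bexI[of _ "inv n"])
  qed
  have gen_C: "carrier G \<subseteq> C h" if "h \<in> carrier G" "S \<subseteq> C h" for h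
    using generate_subgroup_incl[OF that(2) C[OF that(1)]] gen by simp
  have "S \<subseteq> C t" if "t \<in> S" for t using comm S that by (auto simp: C_def)
  then have all: "carrier G \<subseteq> C t" if "t \<in> S" for t using gen_C S that by blast
  have comm_all: "carrier G \<subseteq> C g" if g: "g \<in> carrier G" for g
  proof (rule gen_C[OF g])
    show "S \<subseteq> C g" using all C_sym g S by blast
  qed
  have "derived_set G (carrier G) \<subseteq> N"
  proof clarify
    fix g h assume gh: "g \<in> carrier G" "h \<in> carrier G"
    then obtain n where n: "n \<in> N" "g \<otimes> h = h \<otimes> g \<otimes> n" using comm_all[of h] by (auto simp: C_def)
    \<comment> \<open>The commutator is the conjugate by hg of the error term n.\<close>
    have "g \<otimes> h \<otimes> inv g \<otimes> inv h = (h \<otimes> g) \<otimes> n \<otimes> inv (h \<otimes> g)"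
      using gh n by (simp add: m_assoc inv_mult_group flip: n(2))
    also have "\<dots> \<in> N" using gh n N.inv_op_closed2 by simp
    finally show "g \<otimes> h \<otimes> inv g \<otimes> inv h \<in> N" .
  qed
  then show ?thesis
    unfolding derived_def by (rule generate_subgroup_incl[OF _ N.subgroup_axioms])
qed

text \<open>Here c = g^-1 h^-1 g h, which in the convention of \<open>derived_set\<close> is the
  commutator of the inverses of g and h.\<close>

lemma (in group) commutator_in_derived:
  assumes "g \<in> carrier G" "h \<in> carrier G" "c \<in> carrier G" "g \<otimes> h = h \<otimes> g \<otimes> c"
  shows "c \<in> derived G (carrier G)"
proof -
  have "c = inv (h \<otimes> g) \<otimes> (g \<otimes> h)"
    by (rule inv_solve_left[THEN iffD2]) (use assms in auto)
  then have "c = inv g \<otimes> inv h \<otimes> inv (inv g) \<otimes> inv (inv h)"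
    using assms(1,2) by (simp add: inv_mult_group m_assoc)
  then have "c \<in> derived_set G (carrier G)" using assms(1,2) by blast
  then show ?thesis unfolding derived_def by (rule generate.incl)
qed

text \<open>If k lies in M nothing is added; otherwise kM is disjoint from M and the cardinality
  doubles.\<close>

lemma (in group) card_adjoin_root:
  assumes M: "subgroup M G" and fin: "finite M" and k: "k \<in> carrier G"
    and card: "card M = 2 ^ i"
  shows "\<exists>j. card (M \<union> (\<lambda>m. k \<otimes> m) ` M) = (2::nat) ^ j"
proof -
  interpret M: subgroup M G by fact
  show ?thesis
  proof (cases "k \<in> M")
    case True
    then have "M \<union> (\<lambda>m. k \<otimes> m) ` M = M" by auto
    then show ?thesis using card by auto
  next
    case False
    have "M \<inter> (\<lambda>m. k \<otimes> m) ` M = {}"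
    proof (rule ccontr)
      assume "M \<inter> (\<lambda>m. k \<otimes> m) ` M \<noteq> {}"
      then obtain m where m: "m \<in> M" "k \<otimes> m \<in> M" by blast
      then have "k \<otimes> m \<otimes> inv m \<in> M" by simp
      then show False using m k False by (simp add: m_assoc)
    qed
    moreover have "card ((\<lambda>m. k \<otimes> m) ` M) = card M"
      using k by (intro card_image) (auto simp: inj_on_def)
    ultimately have "card (M \<union> (\<lambda>m. k \<otimes> m) ` M) = 2 ^ Suc i"
      using fin card by (simp add: card_Un_disjoint)
    then show ?thesis by blast
  qed
qed

section \<open>The group SmallGroup(256,511)\<close>

text \<open>
  In the notation of the power-commutator presentation: $f = f_4$, $x = f_3$, $y = f_5$, $z = f_6$, $u = f_7$, $v = f_8$.
\<close>
locale sg_presentation = group G for G (structure) +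
  fixes a b f x y z u v
  assumes closed [simp]: "a \<in> carrier G" "b \<in> carrier G" "f \<in> carrier G" "x \<in> carrier G"
      "y \<in> carrier G" "z \<in> carrier G" "u \<in> carrier G" "v \<in> carrier G"
    and generators: "carrier G = generate G {a, b}"
    and v_neq_one: "v \<noteq> \<one>"
    and squares: "a \<otimes> a = f" "b \<otimes> b = \<one>" "f \<otimes> f = \<one>" "x \<otimes> x = u" "y \<otimes> y = u \<otimes> v"
      "z \<otimes> z = v" "u \<otimes> u = \<one>" "v \<otimes> v = \<one>"
    and conj_a: "b \<otimes> a = a \<otimes> b \<otimes> x" "x \<otimes> a = a \<otimes> x \<otimes> y" "f \<otimes> a = a \<otimes> f" "y \<otimes> a = a \<otimes> y \<otimes> z"
      "z \<otimes> a = a \<otimes> z \<otimes> u" "u \<otimes> a = a \<otimes> u \<otimes> v" "v \<otimes> a = a \<otimes> v"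
    and conj_b: "x \<otimes> b = b \<otimes> x \<otimes> u" "f \<otimes> b = b \<otimes> f \<otimes> y \<otimes> v" "y \<otimes> b = b \<otimes> y \<otimes> u \<otimes> v"
      "z \<otimes> b = b \<otimes> z \<otimes> u" "u \<otimes> b = b \<otimes> u" "v \<otimes> b = b \<otimes> v"
    and conj_x: "y \<otimes> x = x \<otimes> y \<otimes> u" "z \<otimes> x = x \<otimes> z \<otimes> v" "u \<otimes> x = x \<otimes> u" "v \<otimes> x = x \<otimes> v"
    and comm: "z \<otimes> y = y \<otimes> z" "u \<otimes> y = y \<otimes> u" "u \<otimes> z = z \<otimes> u" "v \<otimes> y = y \<otimes> v" "v \<otimes> z = z \<otimes> v"
      "v \<otimes> u = u \<otimes> v"
begin

section \<open>Normal forms and the copy of the group of order 32\<close>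

definition bpow :: "'a \<Rightarrow> bool \<Rightarrow> 'a" where
  "bpow g \<beta> = (if \<beta> then g else \<one>)"

fun embed :: "bits5 \<Rightarrow> 'a" where
  "embed (\<alpha>, \<beta>, \<gamma>, \<delta>, \<epsilon>) = bpow x \<alpha> \<otimes> (bpow y \<beta> \<otimes> (bpow z \<gamma> \<otimes> (bpow u \<delta> \<otimes> bpow v \<epsilon>)))"

lemma bpow_closed [simp]: "g \<in> carrier G \<Longrightarrow> bpow g \<beta> \<in> carrier G"
  by (simp add: bpow_def)

lemma embed_closed [simp]: "embed p \<in> carrier G"
  by (cases p) simp

text \<open>In a right-nested product, two neighbouring letters either end the word or are followed
  by a tail t. This turns each relation into a rewrite rule for the second situation.\<close>

lemma collect_tail:
  assumes "g \<otimes> h = w" "g \<in> carrier G" "h \<in> carrier G" "t \<in> carrier G"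
  shows "g \<otimes> (h \<otimes> t) = w \<otimes> t"
  using assms by (auto simp: m_assoc[symmetric])

lemmas collection_head = squares(4-) conj_x comm

lemmas collection = collection_head collection_head[THEN collect_tail]

lemma embed_generator_mult:
  "x \<otimes> embed p = embed (kmult (True, False, False, False, False) p)"
  "y \<otimes> embed p = embed (kmult (False, True, False, False, False) p)"
  "z \<otimes> embed p = embed (kmult (False, False, True, False, False) p)"
  "u \<otimes> embed p = embed (kmult (False, False, False, True, False) p)"
  "v \<otimes> embed p = embed (kmult (False, False, False, False, True) p)"
  by (cases p; rename_tac \<alpha> \<beta> \<gamma> \<delta> \<epsilon>; case_tac \<alpha>; case_tac \<beta>; case_tac \<gamma>; case_tac \<delta>; case_tac \<epsilon>;
      simp add: bpow_def collection m_assoc)+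

text \<open>The letters of p are moved into the normal form of q one at a time. Collection is thus
  required only for left multiplication by a single letter, and associativity of
  \<open>kmult\<close> does the rest.\<close>

lemma embed_mult: "embed (kmult p q) = embed p \<otimes> embed q"
proof -
  let ?O = "(False, False, False, False, False)"
  obtain \<alpha> \<beta> \<gamma> \<delta> \<epsilon> where p: "p = (\<alpha>, \<beta>, \<gamma>, \<delta>, \<epsilon>)" by (cases p)
  have O: "kmult ?O r = r" for r by (cases r) simp
  have gens: "bpow x \<beta> \<otimes> embed r = embed (kmult (if \<beta> then (True, False, False, False, False) else ?O) r)"
    "bpow y \<beta> \<otimes> embed r = embed (kmult (if \<beta> then (False, True, False, False, False) else ?O) r)"
    "bpow z \<beta> \<otimes> embed r = embed (kmult (if \<beta> then (False, False, True, False, False) else ?O) r)"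
    "bpow u \<beta> \<otimes> embed r = embed (kmult (if \<beta> then (False, False, False, True, False) else ?O) r)"
    "bpow v \<beta> \<otimes> embed r = embed (kmult (if \<beta> then (False, False, False, False, True) else ?O) r)"
    for \<beta> r
    by (simp_all add: bpow_def O embed_generator_mult del: kmult.simps embed.simps)
  have "embed p \<otimes> embed q =
      bpow x \<alpha> \<otimes> (bpow y \<beta> \<otimes> (bpow z \<gamma> \<otimes> (bpow u \<delta> \<otimes> (bpow v \<epsilon> \<otimes> embed q))))"
    unfolding p embed.simps[of \<alpha>] by (simp add: m_assoc del: embed.simps)
  also have "\<dots> = embed (kmult p q)"
    unfolding gens kmult_assoc[symmetric] p
    by (cases \<alpha>; cases \<beta>; cases \<gamma>; cases \<delta>; cases \<epsilon>) simp_all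
  finally show ?thesis by simp
qed

lemma group_hom_embed: "group_hom kgroup G embed"
  by (intro group_hom.intro group_kgroup is_group group_hom_axioms.intro homI)
    (simp_all add: kgroup_def embed_mult)

text \<open>Squaring reduces the question to the centre. There v is nontrivial by assumption, and
  the relation ua = auv shows first that u and then that uv is nontrivial.\<close>

lemma embed_eq_one: "embed p = \<one> \<longleftrightarrow> p = (False, False, False, False, False)"
proof
  have u: "u \<noteq> \<one>"
  proof
    assume "u = \<one>"
    then have "a \<otimes> v = a \<otimes> \<one>" using conj_a(6) by simp
    then show False using v_neq_one by simp
  qed
  have uv: "u \<otimes> v \<noteq> \<one>"
  proof
    assume *: "u \<otimes> v = \<one>"
    then have "u \<otimes> a = a" using conj_a(6) by (simp add: m_assoc)
    then show False using u by simp
  qed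
  have cent: "\<not> d \<and> \<not> e" if "embed (False, False, False, d, e) = \<one>" for d e
    using that u uv v_neq_one by (cases d; cases e) (simp_all add: bpow_def)
  assume p: "embed p = \<one>"
  then have "embed (kmult p p) = \<one>" by (simp add: embed_mult)
  moreover obtain d e where sq: "kmult p p = (False, False, False, d, e)" by (cases p) simp
  ultimately have "kmult p p = (False, False, False, False, False)" using cent by metis
  then obtain d e where "p = (False, False, False, d, e)" using kmult_square_eq_one_iff by blast
  then show "p = (False, False, False, False, False)" using cent p by blast
qed (simp add: bpow_def)

lemma embed_inj: "inj embed"
proof -
  interpret group_hom kgroup G embed by (rule group_hom_embed)
  have "kernel kgroup G embed = {\<one>\<^bsub>kgroup\<^esub>}"
    by (auto simp: kernel_def embed_eq_one kgroup_def simp del: embed.simps)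
  then show ?thesis using inj_iff_trivial_ker by (simp add: kgroup_def)
qed

section \<open>The normal forms constitute the derived subgroup\<close>

definition words :: "'a set" where
  "words = range embed"

lemma words_subgroup: "subgroup words G"
proof -
  interpret group_hom kgroup G embed by (rule group_hom_embed)
  show ?thesis using img_is_subgroup by (simp add: kgroup_def words_def)
qed

lemmas words_closed [simp] = subgroup.mem_carrier[OF words_subgroup]
  and words_mult [simp] = subgroup.m_closed[OF words_subgroup]

lemma card_words: "card words = 2 ^ 5"
proof -
  have "card words = card (UNIV :: bits5 set)" unfolding words_def by (rule card_image[OF embed_inj])
  also have "\<dots> = 2 ^ 5"
    by (simp add: card_cartesian_product card_UNIV_bool flip: UNIV_Times_UNIV)
  finally show ?thesis .
qed

lemma finite_words: "finite words"
  by (simp add: words_def)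

lemma words_generators [simp]: "x \<in> words" "y \<in> words" "z \<in> words" "u \<in> words" "v \<in> words"
proof -
  have "embed (True, False, False, False, False) \<in> words" "embed (False, True, False, False, False) \<in> words"
    "embed (False, False, True, False, False) \<in> words" "embed (False, False, False, True, False) \<in> words"
    "embed (False, False, False, False, True) \<in> words"
    unfolding words_def by (rule rangeI)+
  then show "x \<in> words" "y \<in> words" "z \<in> words" "u \<in> words" "v \<in> words"
    by (simp_all add: bpow_def)
qed

lemma words_subset:
  assumes "subgroup T G" "x \<in> T" "y \<in> T" "z \<in> T" "u \<in> T" "v \<in> T"
  shows "words \<subseteq> T"
proof -
  interpret T: subgroup T G by fact
  have "embed p \<in> T" for p using assms(2-) by (cases p) (simp add: bpow_def)
  then show ?thesis by (auto simp: words_def simp del: embed.simps)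
qed

text \<open>The elements that can be moved past g, with the result on the right in
  \<open>words\<close>, are closed under products. As the five letters have this property, so do all
  normal forms.\<close>

lemma words_normalized:
  assumes g: "g \<in> carrier G" and n: "n \<in> words"
    and gens: "x \<otimes> g = g \<otimes> x'" "y \<otimes> g = g \<otimes> y'" "z \<otimes> g = g \<otimes> z'" "u \<otimes> g = g \<otimes> u'" "v \<otimes> g = g \<otimes> v'"
    and words: "x' \<in> words" "y' \<in> words" "z' \<in> words" "u' \<in> words" "v' \<in> words"
  shows "\<exists>n' \<in> words. n \<otimes> g = g \<otimes> n'"
proof -
  define T where "T = {n \<in> carrier G. \<exists>n' \<in> words. n \<otimes> g = g \<otimes> n'}"
  have mult: "m \<otimes> n \<in> T" if mn: "m \<in> T" "n \<in> T" for m n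
  proof -
    obtain m' where m: "m \<in> carrier G" "m' \<in> words" "m \<otimes> g = g \<otimes> m'" using mn by (auto simp: T_def)
    obtain n' where n: "n \<in> carrier G" "n' \<in> words" "n \<otimes> g = g \<otimes> n'" using mn by (auto simp: T_def)
    have "m \<otimes> n \<otimes> g = m \<otimes> g \<otimes> n'" using m(1) n g by (simp add: m_assoc)
    also have "\<dots> = g \<otimes> (m' \<otimes> n')" using m(2,3) n(2) g by (simp add: m_assoc)
    finally show ?thesis using m n words_mult unfolding T_def by blast
  qed
  have one: "\<one> \<in> T" using subgroup.one_closed[OF words_subgroup] g by (force simp: T_def)
  have "x \<in> T" "y \<in> T" "z \<in> T" "u \<in> T" "v \<in> T" using gens words by (auto simp: T_def)
  then have "embed p \<in> T" for p by (cases p) (simp add: bpow_def mult one)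
  then show ?thesis using n unfolding T_def words_def by blast
qed

lemma words_normalized_a:
  assumes "n \<in> words" shows "\<exists>n' \<in> words. n \<otimes> a = a \<otimes> n'"
  by (rule words_normalized[OF closed(1) assms, of "x \<otimes> y" "y \<otimes> z" "z \<otimes> u" "u \<otimes> v" v])
    (simp_all add: conj_a m_assoc)

lemma words_normalized_b:
  assumes "n \<in> words" shows "\<exists>n' \<in> words. n \<otimes> b = b \<otimes> n'"
  by (rule words_normalized[OF closed(2) assms, of "x \<otimes> u" "y \<otimes> (u \<otimes> v)" "z \<otimes> u" u v])
    (simp_all add: conj_b m_assoc)

text \<open>Since f = a^2, moving past a twice suffices.\<close>

lemma words_normalized_f:
  assumes "n \<in> words" shows "\<exists>n' \<in> words. n \<otimes> f = f \<otimes> n'"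
proof -
  have af: "a \<otimes> (a \<otimes> t) = f \<otimes> t" if "t \<in> carrier G" for t
    using that squares(1) by (simp add: m_assoc[symmetric])
  obtain m where m: "m \<in> words" "n \<otimes> a = a \<otimes> m" using words_normalized_a assms by blast
  obtain k where k: "k \<in> words" "m \<otimes> a = a \<otimes> k" using words_normalized_a m by blast
  have "n \<otimes> f = (n \<otimes> a) \<otimes> a" using assms by (simp add: m_assoc flip: squares(1))
  also have "\<dots> = a \<otimes> (m \<otimes> a)" using m by (simp add: m_assoc)
  also have "\<dots> = f \<otimes> k" using k af by simp
  finally show ?thesis using k by blast
qed

lemma words_normal: "words \<lhd> G"
  by (rule normal_if_generators_normalize[OF words_subgroup finite_words _ generators])
    (use words_normalized_a words_normalized_b in auto)

text \<open>Modulo \<open>words\<close> the generators a and b commute, which bounds the derived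
  subgroup from above. Conversely, x, y, z, u, v arise as successive commutators with a, starting
  from b.\<close>

lemma derived_eq_words: "derived G (carrier G) = words"
proof
  have ab: "a \<otimes> b = b \<otimes> a \<otimes> inv x" using conj_a(1) by (simp add: m_assoc)
  show "derived G (carrier G) \<subseteq> words"
  proof (rule derived_subset_if_generators_commute_mod[OF words_normal _ generators])
    have one: "\<one> \<in> words" by (rule subgroup.one_closed[OF words_subgroup])
    fix s t assume "s \<in> {a, b}" "t \<in> {a, b}"
    moreover have "\<exists>n\<in>words. s \<otimes> s = s \<otimes> s \<otimes> n" if "s \<in> carrier G" for s
      using that one by (intro bexI[of _ \<one>]) simp_all
    moreover have "\<exists>n\<in>words. b \<otimes> a = a \<otimes> b \<otimes> n" using conj_a(1) words_generators(1) by blast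
    moreover have "\<exists>n\<in>words. a \<otimes> b = b \<otimes> a \<otimes> n"
      using ab subgroup.m_inv_closed[OF words_subgroup words_generators(1)] by blast
    ultimately show "\<exists>n\<in>words. s \<otimes> t = t \<otimes> s \<otimes> n" using one by auto
  qed simp
  show "words \<subseteq> derived G (carrier G)"
  proof (rule words_subset)
    show "subgroup (derived G (carrier G)) G" by (simp add: derived_is_subgroup)
    show "x \<in> derived G (carrier G)" by (rule commutator_in_derived[of b a]) (simp_all add: conj_a)
    show "y \<in> derived G (carrier G)" by (rule commutator_in_derived[of x a]) (simp_all add: conj_a)
    show "z \<in> derived G (carrier G)" by (rule commutator_in_derived[of y a]) (simp_all add: conj_a)
    show "u \<in> derived G (carrier G)" by (rule commutator_in_derived[of z a]) (simp_all add: conj_a)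
    show "v \<in> derived G (carrier G)" by (rule commutator_in_derived[of u a]) (simp_all add: conj_a)
  qed
qed

lemma commutator_subgroup_iso: "commutator_subgroup G \<cong> kgroup"
proof -
  have "embed \<in> iso kgroup (commutator_subgroup G)"
    unfolding derived_eq_words
    by (rule isoI) (auto simp: hom_def kgroup_def embed_mult words_def bij_betw_def embed_inj
        simp del: embed.simps split_paired_All)
  then show ?thesis using group.iso_sym[OF group_kgroup] by (auto simp: is_iso_def)
qed

section \<open>The order of the presented group\<close>

text \<open>Adjoin f, b and a to \<open>words\<close> in this order. Each normalizes the preceding
  subgroup and has its square in it, so the cardinality stays a power of two, and the last subgroup
  contains both generators.\<close>

lemma order_power_of_two: "\<exists>n. order G = 2 ^ n"
proof -
  define N1 where "N1 = words \<union> (\<lambda>m. f \<otimes> m) ` words"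
  define N2 where "N2 = N1 \<union> (\<lambda>m. b \<otimes> m) ` N1"
  define N3 where "N3 = N2 \<union> (\<lambda>m. a \<otimes> m) ` N2"
  have one: "\<one> \<in> words" by (rule subgroup.one_closed[OF words_subgroup])
  have N1: "subgroup N1 G"
    unfolding N1_def
    by (rule subgroup_adjoin_root[OF words_subgroup]) (simp_all add: squares one words_normalized_f)
  have W1: "words \<subseteq> N1" by (auto simp: N1_def)
  have f1: "f \<in> N1" using one by (force simp: N1_def)
  have N1m: "g \<otimes> h \<in> N1" if "g \<in> N1" "h \<in> N1" for g h using N1 that by (rule subgroup.m_closed)
  have N1c: "g \<in> carrier G" if "g \<in> N1" for g using N1 that by (rule subgroup.mem_carrier)
  have norm1b: "\<exists>m'\<in>N1. m \<otimes> b = b \<otimes> m'" if m: "m \<in> N1" for m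
  proof (cases "m \<in> words")
    case True
    then show ?thesis using words_normalized_b W1 by blast
  next
    case False
    then obtain n where n: "n \<in> words" "m = f \<otimes> n" using m by (auto simp: N1_def)
    obtain n' where n': "n' \<in> words" "n \<otimes> b = b \<otimes> n'" using words_normalized_b n by blast
    have "m \<otimes> b = f \<otimes> b \<otimes> n'" using n n' by (simp add: m_assoc)
    \<comment> \<open>Moving f past b produces the extra factor yv, which lies in
      \<open>words\<close>.\<close>
    also have "\<dots> = b \<otimes> (f \<otimes> (y \<otimes> (v \<otimes> n')))" using n' by (simp add: conj_b m_assoc)
    finally show ?thesis using f1 n' W1 by (intro bexI[of _ "f \<otimes> (y \<otimes> (v \<otimes> n'))"] N1m) auto
  qed
  have N2: "subgroup N2 G"
    unfolding N2_def
    by (rule subgroup_adjoin_root[OF N1]) (use one W1 norm1b in \<open>auto simp: squares\<close>)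
  have N12: "N1 \<subseteq> N2" by (auto simp: N2_def)
  have b2: "b \<in> N2" using one W1 by (force simp: N2_def)
  have norm1a: "\<exists>m'\<in>N1. m \<otimes> a = a \<otimes> m'" if m: "m \<in> N1" for m
  proof (cases "m \<in> words")
    case True
    then show ?thesis using words_normalized_a W1 by blast
  next
    case False
    then obtain n where n: "n \<in> words" "m = f \<otimes> n" using m by (auto simp: N1_def)
    obtain n' where n': "n' \<in> words" "n \<otimes> a = a \<otimes> n'" using words_normalized_a n by blast
    have "m \<otimes> a = f \<otimes> a \<otimes> n'" using n n' by (simp add: m_assoc)
    also have "\<dots> = a \<otimes> (f \<otimes> n')" using n' by (simp add: conj_a m_assoc)
    finally show ?thesis using f1 n' W1 by (intro bexI[of _ "f \<otimes> n'"] N1m) auto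
  qed
  have norm2a: "\<exists>m'\<in>N2. m \<otimes> a = a \<otimes> m'" if m: "m \<in> N2" for m
  proof (cases "m \<in> N1")
    case True
    then show ?thesis using norm1a N12 by blast
  next
    case False
    then obtain n where n: "n \<in> N1" "m = b \<otimes> n" using m by (auto simp: N2_def)
    obtain n' where n': "n' \<in> N1" "n \<otimes> a = a \<otimes> n'" using norm1a n by blast
    have "m \<otimes> a = b \<otimes> a \<otimes> n'" using n n' by (simp add: m_assoc N1c)
    also have "\<dots> = a \<otimes> (b \<otimes> (x \<otimes> n'))" using n' by (simp add: conj_a m_assoc N1c)
    finally show ?thesis using N1m[OF subsetD[OF W1 words_generators(1)] n'(1)] unfolding N2_def
      by (intro bexI[of _ "b \<otimes> (x \<otimes> n')"]) auto
  qed
  have N3: "subgroup N3 G"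
    unfolding N3_def
    by (rule subgroup_adjoin_root[OF N2]) (use f1 N12 norm2a in \<open>auto simp: squares\<close>)
  have "a \<in> N3" using one W1 N12 by (force simp: N3_def)
  moreover have "b \<in> N3" using b2 by (auto simp: N3_def)
  ultimately have "generate G {a, b} \<subseteq> N3" by (intro generate_subgroup_incl[OF _ N3]) auto
  then have eq: "carrier G = N3" using generators subgroup.subset[OF N3] by auto
  have fin1: "finite N1" and fin2: "finite N2" using finite_words by (simp_all add: N1_def N2_def)
  obtain i where "card N1 = 2 ^ i"
    using card_adjoin_root[OF words_subgroup finite_words closed(3) card_words] unfolding N1_def by blast
  then obtain j where "card N2 = 2 ^ j"
    using card_adjoin_root[OF N1 fin1 closed(2)] unfolding N2_def by blast
  then obtain k where "card N3 = 2 ^ k"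
    using card_adjoin_root[OF N2 fin2 closed(1)] unfolding N3_def by blast
  then show ?thesis by (auto simp: order_def eq)
qed

end


section \<open>The permutation group satisfies the presentation\<close>

lemma SG_a_permutes: "SG_a permutes {1..16}"
  unfolding SG_a_def
  by (intro permutes_compose permutes_subset[OF cycle_permutes]) auto

lemma SG_b_permutes: "SG_b permutes {1..16}"
  unfolding SG_b_def
  by (intro permutes_compose permutes_subset[OF cycle_permutes]) auto

lemma generators_in_sym_group: "{SG_a, SG_b} \<subseteq> carrier (sym_group 16)"
  using SG_a_permutes SG_b_permutes by (simp add: sym_group_carrier)

lemma group_SmallGroup: "group SmallGroup_256_511"
  unfolding SmallGroup_256_511_def
  using group.subgroup_imp_group group.generate_is_subgroup generators_in_sym_group sym_group_is_group
  by blast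

lemma SmallGroup_simps:
  "mult SmallGroup_256_511 = (\<circ>)" "one SmallGroup_256_511 = id"
  by (simp_all add: SmallGroup_256_511_def sym_group_def)

lemma SmallGroup_generators:
  "SG_a \<in> carrier SmallGroup_256_511" "SG_b \<in> carrier SmallGroup_256_511"
  by (auto simp: SmallGroup_256_511_def intro: generate.incl)

text \<open>Generation inside the subgroup agrees with generation in the ambient symmetric group;
  the locale \<open>sg_presentation\<close> expects the former.\<close>

lemma carrier_SmallGroup:
  "carrier SmallGroup_256_511 = generate SmallGroup_256_511 {SG_a, SG_b}"
proof -
  interpret S: group "sym_group 16" by (rule sym_group_is_group)
  show ?thesis
    using S.generate_consistent[OF _ S.generate_is_subgroup[OF generators_in_sym_group], of "{SG_a, SG_b}"]
    by (auto simp: SmallGroup_256_511_def intro: generate.incl)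
qed

lemma finite_SmallGroup: "finite (carrier SmallGroup_256_511)"
proof (rule finite_subset)
  show "carrier SmallGroup_256_511 \<subseteq> carrier (sym_group 16)"
    using group.generate_in_carrier[OF sym_group_is_group generators_in_sym_group]
    by (auto simp: SmallGroup_256_511_def)
  show "finite (carrier (sym_group 16))"
    by (simp add: sym_group_def finite_permutations)
qed

text \<open>The relations are identities between functions, so membership of the further elements in
  the group has to be derived: f, u, v are squares of members, while x, y, z are quotients of
  members by the commutator relations with \<open>SG_a\<close>.\<close>

lemma SmallGroup_sg_presentation:
  "\<exists>f x y z u v. sg_presentation SmallGroup_256_511 SG_a SG_b f x y z u v"
proof -
  interpret G: group SmallGroup_256_511 by (rule group_SmallGroup)
  obtain x f y z u v where neq: "v \<noteq> id"
    and rels: "SG_a \<circ> SG_a = f" "SG_b \<circ> SG_b = id" "x \<circ> x = u" "f \<circ> f = id" "y \<circ> y = u \<circ> v"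
      "z \<circ> z = v" "u \<circ> u = id" "v \<circ> v = id" "SG_b \<circ> SG_a = SG_a \<circ> SG_b \<circ> x"
      "x \<circ> SG_a = SG_a \<circ> x \<circ> y" "x \<circ> SG_b = SG_b \<circ> x \<circ> u" "f \<circ> SG_a = SG_a \<circ> f"
      "f \<circ> SG_b = SG_b \<circ> f \<circ> y \<circ> v"
      "y \<circ> SG_a = SG_a \<circ> y \<circ> z" "y \<circ> SG_b = SG_b \<circ> y \<circ> u \<circ> v" "y \<circ> x = x \<circ> y \<circ> u"
      "z \<circ> SG_a = SG_a \<circ> z \<circ> u" "z \<circ> SG_b = SG_b \<circ> z \<circ> u"
      "z \<circ> x = x \<circ> z \<circ> v" "z \<circ> y = y \<circ> z"
      "u \<circ> SG_a = SG_a \<circ> u \<circ> v" "u \<circ> SG_b = SG_b \<circ> u" "u \<circ> x = x \<circ> u"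
      "u \<circ> y = y \<circ> u" "u \<circ> z = z \<circ> u" "v \<circ> SG_a = SG_a \<circ> v" "v \<circ> SG_b = SG_b \<circ> v"
      "v \<circ> x = x \<circ> v" "v \<circ> y = y \<circ> v" "v \<circ> z = z \<circ> v" "v \<circ> u = u \<circ> v"
    using SG_presentation by (elim exE conjE) (rule that)
  have comp: "p \<circ> q \<in> carrier SmallGroup_256_511"
    if "p \<in> carrier SmallGroup_256_511" "q \<in> carrier SmallGroup_256_511" for p q
    using G.m_closed[OF that] by (simp add: SmallGroup_simps)
  have quot: "q \<in> carrier SmallGroup_256_511"
    if p: "p \<in> carrier SmallGroup_256_511" and r: "r \<in> carrier SmallGroup_256_511"
      and eq: "r = p \<circ> q" for p q r
  proof -
    have "inv\<^bsub>SmallGroup_256_511\<^esub> p \<circ> p = id" using G.l_inv[OF p] by (simp add: SmallGroup_simps)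
    then have "q = inv\<^bsub>SmallGroup_256_511\<^esub> p \<circ> r" by (simp add: eq comp_assoc[symmetric])
    then show ?thesis using comp p r by simp
  qed
  note a = SmallGroup_generators(1) and b = SmallGroup_generators(2)
  have f: "f \<in> carrier SmallGroup_256_511" using comp[OF a a] rels(1) by simp
  have x: "x \<in> carrier SmallGroup_256_511" by (rule quot[OF comp[OF a b] comp[OF b a] rels(9)])
  have y: "y \<in> carrier SmallGroup_256_511" by (rule quot[OF comp[OF a x] comp[OF x a] rels(10)])
  have z: "z \<in> carrier SmallGroup_256_511" by (rule quot[OF comp[OF a y] comp[OF y a] rels(14)])
  have u: "u \<in> carrier SmallGroup_256_511" using comp[OF x x] rels(3) by simp
  have v: "v \<in> carrier SmallGroup_256_511" using comp[OF z z] rels(6) by simp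
  have "sg_presentation SmallGroup_256_511 SG_a SG_b f x y z u v"
    by (intro sg_presentation.intro sg_presentation_axioms.intro group_SmallGroup carrier_SmallGroup;
        (unfold SmallGroup_simps)?; fact)
  then show ?thesis by blast
qed

section \<open>Transfer to groups on the natural numbers\<close>

text \<open>Transport of structure along an enumeration of the carrier. The general claim to be
  refuted quantifies over groups on \<open>nat\<close>, whereas the permutation group consists of
  functions.\<close>

lemma finite_group_nat_copy:
  fixes G (structure)
  assumes "group G" and fin: "finite (carrier G)"
  shows "\<exists>N :: nat monoid. group N \<and> G \<cong> N"
proof -
  interpret group G by fact
  obtain h where h: "bij_betw h (carrier G) {0..<card (carrier G)}"
    using ex_bij_betw_finite_nat[OF fin] by blast
  then have inj: "inj_on h (carrier G)" by (simp add: bij_betw_def)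
  define g where "g = inv_into (carrier G) h"
  have g: "g (h m) = m" if "m \<in> carrier G" for m
    using that inj by (simp add: g_def)
  define N where
    "N = \<lparr>carrier = h ` carrier G, mult = (\<lambda>m n. h (g m \<otimes> g n)), one = h \<one>\<rparr>"
  have "group N"
  proof (rule groupI)
    fix m assume "m \<in> carrier N"
    then obtain k where k: "k \<in> carrier G" "m = h k" by (auto simp: N_def)
    then show "\<exists>n \<in> carrier N. n \<otimes>\<^bsub>N\<^esub> m = \<one>\<^bsub>N\<^esub>"
      by (auto simp: N_def g intro!: bexI[of _ "inv k"])
  qed (auto simp: N_def g m_assoc)
  moreover have "h \<in> iso G N"
    using inj by (intro isoI) (auto simp: hom_def N_def g bij_betw_def)
  ultimately show ?thesis by (auto simp: is_iso_def)
qed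

text \<open>A surjective homomorphism maps the derived subgroup onto the derived subgroup, so an
  isomorphism restricts to one between them.\<close>

lemma commutator_subgroup_iso_cong:
  assumes "group G" "group H" "G \<cong> H"
  shows "commutator_subgroup G \<cong> commutator_subgroup H"
proof -
  obtain h where h: "h \<in> iso G H" using assms(3) by (auto simp: is_iso_def)
  interpret group_hom G H h
    using assms(1,2) h by (simp add: group_hom_def group_hom_axioms_def iso_def)
  have "derived H (carrier H) = h ` derived G (carrier G)"
    using derived_img[of "carrier G"] h by (simp add: iso_def bij_betw_def)
  then have "restrict h (derived G (carrier G)) \<in> iso (commutator_subgroup G) (commutator_subgroup H)"
    using iso_restrict[OF h assms(1,2) G.derived_is_subgroup] by simp
  then show ?thesis by (auto simp: is_iso_def)
qed

lemma frattini_group_not_iso_commutator_subgroup: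
  assumes "finite_p_group 2 H"
  shows "\<not> frattini_group H \<cong> commutator_subgroup SmallGroup_256_511"
proof
  assume iso: "frattini_group H \<cong> commutator_subgroup SmallGroup_256_511"
  obtain f x y z u v where "sg_presentation SmallGroup_256_511 SG_a SG_b f x y z u v"
    using SmallGroup_sg_presentation by blast
  then have "commutator_subgroup SmallGroup_256_511 \<cong> kgroup"
    by (rule sg_presentation.commutator_subgroup_iso)
  with iso have "frattini_group H \<cong> kgroup" by (rule iso_trans)
  then show False
    using assms group.frattini_not_iso_kgroup by (auto simp: finite_p_group_def)
qed

lemma finite_2_group_SmallGroup: "finite_p_group 2 SmallGroup_256_511"
  using SmallGroup_sg_presentation sg_presentation.order_power_of_two group_SmallGroup finite_SmallGroup
  by (auto simp: finite_p_group_def)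

theorem mainTheorem3:
  shows "\<not> (\<forall>p::nat. Factorial_Ring.prime p \<longrightarrow>
             (\<forall>G :: nat monoid. finite_p_group p G \<longrightarrow>
                (\<exists>H :: nat monoid. finite_p_group p H \<and> frattini_group H \<cong> commutator_subgroup G)))
       \<and> finite_p_group 2 SmallGroup_256_511
       \<and> \<not> (\<exists>H :: 'h monoid. finite_p_group 2 H \<and>
               frattini_group H \<cong> commutator_subgroup SmallGroup_256_511)"
proof (intro conjI)
  show "finite_p_group 2 SmallGroup_256_511" by (rule finite_2_group_SmallGroup)
  show "\<not> (\<exists>H :: 'h monoid. finite_p_group 2 H \<and>
      frattini_group H \<cong> commutator_subgroup SmallGroup_256_511)"
    using frattini_group_not_iso_commutator_subgroup by blast
  \<comment> \<open>The counterexample to the general claim is p = 2 with a copy of the permutation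
    group on \<open>nat\<close>.\<close>
  obtain N :: "nat monoid" where N: "group N" "SmallGroup_256_511 \<cong> N"
    using finite_group_nat_copy[OF group_SmallGroup finite_SmallGroup] by blast
  have "finite_p_group 2 N"
    using finite_2_group_SmallGroup N iso_same_card[OF N(2)] iso_finite[OF N(2)]
    by (auto simp: finite_p_group_def order_def)
  moreover have "\<not> frattini_group H \<cong> commutator_subgroup N" if H: "finite_p_group 2 H" for H :: "nat monoid"
  proof
    assume "frattini_group H \<cong> commutator_subgroup N"
    moreover have "commutator_subgroup N \<cong> commutator_subgroup SmallGroup_256_511"
      using N group.iso_sym[OF group_SmallGroup N(2)]
      by (intro commutator_subgroup_iso_cong group_SmallGroup)
    ultimately have "frattini_group H \<cong> commutator_subgroup SmallGroup_256_511" by (rule iso_trans)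
    then show False using frattini_group_not_iso_commutator_subgroup[OF H] by blast
  qed
  ultimately show "\<not> (\<forall>p::nat. Factorial_Ring.prime p \<longrightarrow>
             (\<forall>G :: nat monoid. finite_p_group p G \<longrightarrow>
                (\<exists>H :: nat monoid. finite_p_group p H \<and> frattini_group H \<cong> commutator_subgroup G)))"
    using two_is_prime_nat by blast
qed

end
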